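(* Let $A\in\mathcal L(\mathcal G)$ be an $M$-hyponormal operator for some $M>0$, let $B\in\mathcal L(\mathcal K)$ be a dominant operator, let $T\in\mathcal L(\mathcal H)$, and let $W_1\in\mathcal L(\mathcal G,\mathcal H)$ and $W_2\in\mathcal L(\mathcal H,\mathcal K)$ be nonzero operators such that $W_1A^*=TW_1$ and $W_2T=BW_2$. If $T\neq\lambda I$ for every $\lambda\in\mathbb C$, then $T$ has a nontrivial hyperinvariant subspace.
   Context: All spaces are complex separable Hilbert spaces. An operator $A$ is $M$-hyponormal if $\|(A-\lambda)^*x\|\le M^{1/2}\|(A-\lambda)x\|$ for every $\lambda\in\mathbb C$ and every vector $x$. An operator $B$ is dominant if for every $\lambda\in\mathbb C$ there is a constant $M_\lambda$ with $\|(B-\lambda)^*x\|\le M_\lambda^{1/2}\|(B-\lambda)x\|$ for every $x$. A closed subspace is hyperinvariant for $T$ if it is invariant under every operator commuting with $T$; nontrivial means different from $\{0\}$ and $\mathcal H$. *)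

theory Defs
  imports "HOL-Analysis.Analysis"
begin

class complex_vector = real_vector +
  fixes scaleC :: "complex \<Rightarrow> 'a \<Rightarrow> 'a" (infixr \<open>*\<^sub>C\<close> 75)
  assumes scaleC_add_right: "a *\<^sub>C (x + y) = a *\<^sub>C x + a *\<^sub>C y"
    and scaleC_add_left: "(a + b) *\<^sub>C x = a *\<^sub>C x + b *\<^sub>C x"
    and scaleC_scaleC: "a *\<^sub>C (b *\<^sub>C x) = (a * b) *\<^sub>C x"
    and scaleC_one: "1 *\<^sub>C x = x"
    and scaleR_scaleC: "scaleR r x = complex_of_real r *\<^sub>C x"

class complex_inner = complex_vector + real_normed_vector +
  fixes cinner :: "'a \<Rightarrow> 'a \<Rightarrow> complex"
  assumes cinner_commute: "cinner x y = cnj (cinner y x)"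
    and cinner_add_right: "cinner x (y + z) = cinner x y + cinner x z"
    and cinner_scaleC_right: "cinner x (a *\<^sub>C y) = a * cinner x y"
    and cinner_nonneg: "0 \<le> Re (cinner x x)"
    and cinner_eq_zero_iff: "cinner x x = 0 \<longleftrightarrow> x = 0"
    and norm_eq_sqrt_cinner: "norm x = sqrt (Re (cinner x x))"

class chilbert_space = complex_inner + complete_space

instantiation complex :: complex_inner
begin
definition scaleC_complex_def: "scaleC a (x::complex) = a * x"
definition cinner_complex_def: "cinner (x::complex) y = cnj x * y"
instance
proof
  fix x y z a b :: complex and r :: real
  show "a *\<^sub>C (x + y) = a *\<^sub>C x + a *\<^sub>C y" by (simp add: scaleC_complex_def algebra_simps)
  show "(a + b) *\<^sub>C x = a *\<^sub>C x + b *\<^sub>C x" by (simp add: scaleC_complex_def algebra_simps)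
  show "a *\<^sub>C (b *\<^sub>C x) = (a * b) *\<^sub>C x" by (simp add: scaleC_complex_def algebra_simps)
  show "1 *\<^sub>C x = x" by (simp add: scaleC_complex_def)
  show "scaleR r x = complex_of_real r *\<^sub>C x" by (simp add: scaleC_complex_def scaleR_conv_of_real)
  show "cinner x y = cnj (cinner y x)" by (simp add: cinner_complex_def mult.commute)
  show "cinner x (y + z) = cinner x y + cinner x z" by (simp add: cinner_complex_def algebra_simps)
  show "cinner x (a *\<^sub>C y) = a * cinner x y" by (simp add: cinner_complex_def scaleC_complex_def algebra_simps)
  show "0 \<le> Re (cinner x x)" by (simp add: cinner_complex_def)
  show "cinner x x = 0 \<longleftrightarrow> x = 0" by (simp add: cinner_complex_def)
  show "norm x = sqrt (Re (cinner x x))"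
    by (simp add: cinner_complex_def cmod_def power2_eq_square)
qed
end

instance complex :: chilbert_space ..

definition separable_space :: "'a::topological_space itself \<Rightarrow> bool" where
  "separable_space _ \<longleftrightarrow> (\<exists>D::'a set. countable D \<and> closure D = UNIV)"

definition bounded_clinear :: "('a::complex_inner \<Rightarrow> 'b::complex_inner) \<Rightarrow> bool" where
  "bounded_clinear f \<longleftrightarrow>
     (\<forall>x y. f (x + y) = f x + f y) \<and> (\<forall>c x. f (c *\<^sub>C x) = c *\<^sub>C f x) \<and>
     (\<exists>K. \<forall>x. norm (f x) \<le> norm x * K)"

text \<open>The Hilbert-space adjoint (exists and is unique for bounded operators between Hilbert spaces).\<close>
definition is_adjoint :: "('a::complex_inner \<Rightarrow> 'b::complex_inner) \<Rightarrow> ('b \<Rightarrow> 'a) \<Rightarrow> bool" where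
  "is_adjoint A A' \<longleftrightarrow> (\<forall>x y. cinner (A x) y = cinner x (A' y))"

definition adjoint :: "('a::complex_inner \<Rightarrow> 'b::complex_inner) \<Rightarrow> ('b \<Rightarrow> 'a)" where
  "adjoint A = (SOME A'. is_adjoint A A')"

definition shift :: "('a::complex_inner \<Rightarrow> 'a) \<Rightarrow> complex \<Rightarrow> 'a \<Rightarrow> 'a" where
  "shift A l = (\<lambda>x. A x - l *\<^sub>C x)"

definition M_hyponormal :: "real \<Rightarrow> ('a::complex_inner \<Rightarrow> 'a) \<Rightarrow> bool" where
  "M_hyponormal M A \<longleftrightarrow> bounded_clinear A \<and>
     (\<forall>l x. norm (adjoint (shift A l) x) \<le> sqrt M * norm (shift A l x))"

definition dominant :: "('a::complex_inner \<Rightarrow> 'a) \<Rightarrow> bool" where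
  "dominant B \<longleftrightarrow> bounded_clinear B \<and>
     (\<forall>l. \<exists>M. \<forall>x. norm (adjoint (shift B l) x) \<le> sqrt M * norm (shift B l x))"

definition csubspace :: "'a::complex_vector set \<Rightarrow> bool" where
  "csubspace S \<longleftrightarrow> 0 \<in> S \<and> (\<forall>x\<in>S. \<forall>y\<in>S. x + y \<in> S) \<and> (\<forall>c. \<forall>x\<in>S. c *\<^sub>C x \<in> S)"

definition hyperinvariant :: "'a::complex_inner set \<Rightarrow> ('a \<Rightarrow> 'a) \<Rightarrow> bool" where
  "hyperinvariant S T \<longleftrightarrow> csubspace S \<and> closed S \<and>
     (\<forall>X. bounded_clinear X \<and> X \<circ> T = T \<circ> X \<longrightarrow> X ` S \<subseteq> S)"

definition has_nontrivial_hyperinvariant_subspace :: "('a::complex_inner \<Rightarrow> 'a) \<Rightarrow> bool" where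
  "has_nontrivial_hyperinvariant_subspace T \<longleftrightarrow>
     (\<exists>S. hyperinvariant S T \<and> S \<noteq> {0} \<and> S \<noteq> UNIV)"

end

theory Submission
  imports "HOL-Complex_Analysis.Cauchy_Integral_Formula" Defs
begin

text \<open>Write \<open>S = A\<^sup>*\<close>. Whenever \<open>X\<close> commutes with \<open>T\<close>, the operator \<open>Y = W\<^sub>2 X W\<^sub>1\<close> satisfies
  \<open>Y S = B Y\<close>. A vector \<open>y\<close> for which \<open>(B - m) g = y\<close> has a solution locally bounded in \<open>m\<close> on the
  whole plane must vanish, by Liouville's theorem applied to \<open>\<langle>y, g m\<rangle>\<close>. Hyponormality of \<open>A\<close> puts
  all vectors \<open>Y (S A - A S) x\<close> into this class, so every intertwiner \<open>Y\<close> factors through a normal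
  part of \<open>S\<close>, and one may take \<open>S\<close> to be normal.

  For normal \<open>S\<close>, vectors spectrally supported outside and inside two concentric discs of different
  radii have orthogonal images under any two intertwiners, because \<open>\<Inter>\<^sub>m ran (S - m) = 0\<close>. If some
  intertwiner \<open>Y\<^sub>0\<close> does not kill either kind of vectors, with \<open>k = Y\<^sub>0 f\<close> for an outer vector \<open>f\<close>
  the subspace of all \<open>v\<close> such that \<open>\<langle>k, W\<^sub>2 X v\<rangle> = 0\<close> for every \<open>X\<close> commuting with \<open>T\<close> is the desired
  one. Otherwise \<open>Y\<^sub>0 S = l Y\<^sub>0\<close> for a scalar \<open>l\<close>; then \<open>k = Y\<^sub>0 f\<close> is an eigenvector of \<open>B\<close>, hence by
  dominance one of \<open>B\<^sup>*\<close>, and the same subspace contains the range of \<open>T - l\<close>. If all intertwiners vanish,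
  the vectors annihilated by every \<open>W\<^sub>2 X\<close> form the desired subspace.\<close>


section \<open>Complex inner product spaces\<close>

lemma scaleC_zero_left [simp]: "0 *\<^sub>C x = (0::'a::complex_vector)"
  using scaleR_scaleC[of 0 x] by simp

lemma scaleC_zero_right [simp]: "a *\<^sub>C 0 = (0::'a::complex_vector)"
  using scaleC_add_right[of a 0 0] by simp

lemma scaleC_minus_right [simp]: "a *\<^sub>C (- x) = - (a *\<^sub>C (x::'a::complex_vector))"
  using scaleC_add_right[of a x "- x"] by (simp add: add_eq_0_iff)

lemma scaleC_minus_left [simp]: "(- a) *\<^sub>C x = - (a *\<^sub>C (x::'a::complex_vector))"
  using scaleC_add_left[of a "- a" x] by (simp add: add_eq_0_iff)

lemma scaleC_diff_right: "a *\<^sub>C (x - y) = a *\<^sub>C x - a *\<^sub>C (y::'a::complex_vector)"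
  using scaleC_add_right[of a x "- y"] by simp

lemma scaleC_diff_left: "(a - b) *\<^sub>C x = a *\<^sub>C x - b *\<^sub>C (x::'a::complex_vector)"
  using scaleC_add_left[of a "- b" x] by simp

lemmas scaleC_distribs = scaleC_add_right scaleC_add_left scaleC_diff_right scaleC_diff_left

lemma cinner_zero_right [simp]: "cinner x 0 = 0"
  using cinner_add_right[of x 0 0] by simp

lemma cinner_minus_right [simp]: "cinner x (- y) = - cinner x y"
  using cinner_add_right[of x y "- y"] by (simp add: add_eq_0_iff)

lemma cinner_diff_right: "cinner x (y - z) = cinner x y - cinner x z"
  using cinner_add_right[of x y "- z"] by simp

lemma cinner_scaleR_right [simp]: "cinner x (r *\<^sub>R y) = r *\<^sub>R cinner x y"
  by (simp add: scaleR_scaleC cinner_scaleC_right scaleC_complex_def)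

lemma cinner_add_left: "cinner (x + y) z = cinner x z + cinner y z"
  by (metis cinner_add_right cinner_commute complex_cnj_add)

lemma cinner_zero_left [simp]: "cinner 0 x = 0"
  by (metis cinner_commute cinner_zero_right complex_cnj_zero)

lemma cinner_minus_left [simp]: "cinner (- x) y = - cinner x y"
  by (metis cinner_minus_right cinner_commute complex_cnj_minus)

lemma cinner_diff_left: "cinner (x - y) z = cinner x z - cinner y z"
  by (metis cinner_diff_right cinner_commute complex_cnj_diff)

lemma cinner_scaleC_left: "cinner (a *\<^sub>C x) y = cnj a * cinner x y"
  by (metis cinner_scaleC_right cinner_commute complex_cnj_mult)

lemma cinner_scaleR_left [simp]: "cinner (r *\<^sub>R x) y = r *\<^sub>R cinner x y"
  by (simp add: scaleR_scaleC cinner_scaleC_left scaleC_complex_def)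

lemmas cinner_distribs = cinner_add_left cinner_add_right cinner_diff_left cinner_diff_right
  cinner_scaleC_left cinner_scaleC_right

lemma cinner_self: "cinner x x = of_real ((norm x)\<^sup>2)"
proof -
  have "Im (cinner x x) = 0"
    using arg_cong[OF cinner_commute[of x x], of Im] by simp
  thus ?thesis
    by (simp add: norm_eq_sqrt_cinner[of x] cinner_nonneg complex_eq_iff)
qed

lemma norm_scaleC: "norm (a *\<^sub>C x) = cmod a * norm (x::'a::complex_inner)"
proof -
  have "of_real ((norm (a *\<^sub>C x))\<^sup>2) = (of_real ((cmod a * norm x)\<^sup>2) :: complex)"
  proof -
    have "cinner (a *\<^sub>C x) (a *\<^sub>C x) = (a * cnj a) * cinner x x"
      by (simp add: cinner_distribs)
    thus ?thesis
      by (simp only: cinner_self complex_norm_square[symmetric] of_real_mult[symmetric] power_mult_distrib)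
  qed
  hence "(norm (a *\<^sub>C x))\<^sup>2 = (cmod a * norm x)\<^sup>2"
    by (simp only: of_real_eq_iff)
  thus ?thesis by (simp add: power2_eq_iff_nonneg)
qed

lemma norm_add_square: "(norm (x + y))\<^sup>2 = (norm x)\<^sup>2 + 2 * Re (cinner x y) + (norm y)\<^sup>2"
proof -
  have "Re (cinner (x + y) (x + y)) = Re (cinner x x) + 2 * Re (cinner x y) + Re (cinner y y)"
    using cinner_commute[of y x] by (simp add: cinner_distribs)
  thus ?thesis by (simp add: cinner_self)
qed

lemma norm_diff_square: "(norm (x - y))\<^sup>2 = (norm x)\<^sup>2 - 2 * Re (cinner x y) + (norm y)\<^sup>2"
  using norm_add_square[of x "- y"] by simp

lemma cinner_Cauchy_Schwarz: "cmod (cinner x y) \<le> norm x * norm y"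
proof (cases "x = 0")
  case False
  define a where "a = cinner x y / of_real ((norm x)\<^sup>2)"
  have nx: "norm x > 0" using False by simp
  have "0 \<le> (norm (y - a *\<^sub>C x))\<^sup>2" by simp
  also have "\<dots> = (norm y)\<^sup>2 - 2 * Re (cinner y (a *\<^sub>C x)) + (norm (a *\<^sub>C x))\<^sup>2"
    by (rule norm_diff_square)
  also have "cinner y (a *\<^sub>C x) = (cinner x y * cnj (cinner x y)) / of_real ((norm x)\<^sup>2)"
    using cinner_commute[of y x] by (simp add: cinner_scaleC_right a_def)
  also have "\<dots> = of_real ((cmod (cinner x y))\<^sup>2 / (norm x)\<^sup>2)"
    by (simp only: complex_norm_square[symmetric] of_real_divide)
  also have "(norm (a *\<^sub>C x))\<^sup>2 = (cmod (cinner x y))\<^sup>2 / (norm x)\<^sup>2"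
  proof -
    have "cmod a = cmod (cinner x y) / (norm x)\<^sup>2"
      unfolding a_def norm_divide by (simp only: norm_of_real abs_power2)
    thus ?thesis
      using nx by (simp add: norm_scaleC power2_eq_square)
  qed
  finally have "(cmod (cinner x y))\<^sup>2 \<le> (norm x * norm y)\<^sup>2"
    using nx by (simp add: field_simps power_mult_distrib)
  thus ?thesis by (meson mult_nonneg_nonneg norm_ge_zero power2_le_imp_le)
qed simp

lemma bounded_bilinear_cinner: "bounded_bilinear (cinner :: 'a::complex_inner \<Rightarrow> 'a \<Rightarrow> complex)"
proof
  show "\<exists>K. \<forall>a b::'a. norm (cinner a b) \<le> norm a * norm b * K"
    using cinner_Cauchy_Schwarz by (metis mult.right_neutral)
qed (simp_all add: cinner_add_left cinner_add_right)

lemmas tendsto_cinner = bounded_bilinear.tendsto[OF bounded_bilinear_cinner]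

lemma cinner_commute_cnj [simp]: "cnj (cinner x y) = cinner y x"
  by (simp add: cinner_commute[of y x])

lemma cinner_ext: "x = y" if "\<And>z. cinner z x = cinner z y"
proof -
  have "cinner (x - y) (x - y) = 0" using that[of "x - y"] by (simp add: cinner_diff_right)
  thus ?thesis by (simp add: cinner_eq_zero_iff)
qed

section \<open>Bounded operators\<close>

lemma bounded_clinearI:
  assumes "\<And>x y. f (x + y) = f x + f y" "\<And>c x. f (c *\<^sub>C x) = c *\<^sub>C f x"
    "\<And>x. norm (f x) \<le> K * norm x"
  shows "bounded_clinear f"
  unfolding bounded_clinear_def using assms by (auto simp: mult.commute intro!: exI[of _ K])

lemma bounded_clinear_imp_bounded_linear: "bounded_clinear f \<Longrightarrow> bounded_linear f"
  unfolding bounded_clinear_def bounded_linear_def bounded_linear_axioms_def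
  by (auto simp: scaleR_scaleC intro!: linearI)

lemma bounded_clinear_add: "bounded_clinear f \<Longrightarrow> f (x + y) = f x + f y"
  and bounded_clinear_scaleC: "bounded_clinear f \<Longrightarrow> f (c *\<^sub>C x) = c *\<^sub>C f x"
  by (simp_all add: bounded_clinear_def)

lemma bounded_clinear_zero: "bounded_clinear f \<Longrightarrow> f 0 = 0"
  and bounded_clinear_minus: "bounded_clinear f \<Longrightarrow> f (- x) = - f x"
  and bounded_clinear_diff: "bounded_clinear f \<Longrightarrow> f (x - y) = f x - f y"
  and bounded_clinear_scaleR: "bounded_clinear f \<Longrightarrow> f (r *\<^sub>R x) = r *\<^sub>R f x"
  by (simp_all add: bounded_clinear_imp_bounded_linear bounded_linear.linear
      linear_0 linear_neg linear_diff linear_scale)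

lemmas bounded_clinear_simps = bounded_clinear_add bounded_clinear_scaleC bounded_clinear_zero
  bounded_clinear_minus bounded_clinear_diff bounded_clinear_scaleR

lemma bounded_clinear_bound:
  assumes "bounded_clinear f" obtains K where "K > 0" "\<And>x. norm (f x) \<le> K * norm x"
  using bounded_linear.pos_bounded[OF bounded_clinear_imp_bounded_linear[OF assms]]
  by (auto simp: mult.commute)

lemma continuous_on_bounded_clinear:
  "bounded_clinear f \<Longrightarrow> continuous_on S f"
  by (intro linear_continuous_on bounded_clinear_imp_bounded_linear)

lemma bounded_clinear_id: "bounded_clinear (\<lambda>x. x)"
  by (rule bounded_clinearI[where K = 1]) auto

lemma bounded_clinear_const_zero: "bounded_clinear (\<lambda>x. 0)"
  by (rule bounded_clinearI[where K = 0]) auto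

lemma bounded_clinear_compose:
  assumes "bounded_clinear f" "bounded_clinear g" shows "bounded_clinear (\<lambda>x. f (g x))"
proof -
  have "bounded_linear (\<lambda>x. f (g x))"
    using assms by (rule bounded_linear_compose[OF bounded_clinear_imp_bounded_linear bounded_clinear_imp_bounded_linear])
  from bounded_linear.bounded[OF this] show ?thesis
    using assms by (simp add: bounded_clinear_def)
qed

lemma bounded_clinear_plus:
  assumes "bounded_clinear f" "bounded_clinear g" shows "bounded_clinear (\<lambda>x. f x + g x)"
proof -
  have "bounded_linear (\<lambda>x. f x + g x)"
    using assms by (rule bounded_linear_add[OF bounded_clinear_imp_bounded_linear bounded_clinear_imp_bounded_linear])
  from bounded_linear.bounded[OF this] show ?thesis
    using assms by (simp add: bounded_clinear_def scaleC_add_right add_ac)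
qed

lemma bounded_clinear_scale:
  assumes "bounded_clinear f" shows "bounded_clinear (\<lambda>x. c *\<^sub>C f x)"
proof -
  obtain K where K: "K > 0" "\<And>x. norm (f x) \<le> K * norm x"
    using bounded_clinear_bound[OF assms] by blast
  show ?thesis
  proof (rule bounded_clinearI[where K = "cmod c * K"])
    show "norm (c *\<^sub>C f x) \<le> cmod c * K * norm x" for x
      using K(2)[of x] by (simp add: norm_scaleC mult_left_mono mult.assoc)
  qed (simp_all add: bounded_clinear_simps[OF assms] scaleC_distribs scaleC_scaleC mult.commute)
qed

lemma bounded_clinear_scaleR_fun: "bounded_clinear f \<Longrightarrow> bounded_clinear (\<lambda>x. r *\<^sub>R f x)"
  by (simp add: scaleR_scaleC bounded_clinear_scale)

lemma bounded_clinear_minus_fun: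
  assumes "bounded_clinear f" "bounded_clinear g" shows "bounded_clinear (\<lambda>x. f x - g x)"
  using bounded_clinear_plus[OF assms(1) bounded_clinear_scale[OF assms(2), of "-1"]]
  by (simp add: scaleC_one)

lemma bounded_clinear_shift: "bounded_clinear f \<Longrightarrow> bounded_clinear (shift f l)"
  unfolding shift_def
  by (intro bounded_clinear_minus_fun bounded_clinear_scale bounded_clinear_id)

lemmas bounded_clinear_intros = bounded_clinear_id bounded_clinear_plus bounded_clinear_scale
  bounded_clinear_scaleR_fun bounded_clinear_minus_fun bounded_clinear_shift
  bounded_clinear_const_zero

section \<open>Representation of functionals, adjoints and projections\<close>

text \<open>The vector \<open>h\<close> is the limit of \<open>S x\<close> along a minimizing sequence of
  \<open>\<parallel>S x\<parallel>\<^sup>2 - 2 Re (l x)\<close>. With \<open>S\<close> the identity this is the Riesz representation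
  theorem on a subspace, and in general it is Douglas' range inclusion lemma.\<close>

lemma majorized_functional_representation:
  fixes S :: "'a::complex_vector \<Rightarrow> 'b::chilbert_space" and l :: "'a \<Rightarrow> complex"
  assumes V: "csubspace V"
    and S_add: "\<And>x y. S (x + y) = S x + S y" and S_scale: "\<And>c x. S (c *\<^sub>C x) = c *\<^sub>C S x"
    and l_add: "\<And>x y. l (x + y) = l x + l y" and l_scale: "\<And>c x. l (c *\<^sub>C x) = c * l x"
    and bound: "\<And>x. x \<in> V \<Longrightarrow> cmod (l x) \<le> C * norm (S x)"
  obtains h where "h \<in> closure (S ` V)" "\<And>x. x \<in> V \<Longrightarrow> l x = cinner h (S x)"
proof -
  define J where "J x = (norm (S x))\<^sup>2 - 2 * Re (l x)" for x
  have V0: "0 \<in> V" and V_add: "\<And>x y. x \<in> V \<Longrightarrow> y \<in> V \<Longrightarrow> x + y \<in> V"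
    and V_scale: "\<And>c x. x \<in> V \<Longrightarrow> c *\<^sub>C x \<in> V"
    using V by (auto simp: csubspace_def)
  have S_scaleR: "S (r *\<^sub>R x) = r *\<^sub>R S x" and l_scaleR: "l (r *\<^sub>R x) = r *\<^sub>R l x" for r x
    by (simp_all add: scaleR_scaleC S_scale l_scale scaleC_complex_def)
  have V_scaleR: "x \<in> V \<Longrightarrow> r *\<^sub>R x \<in> V" for r x
    by (simp add: scaleR_scaleC V_scale)
  have J_ge: "J x \<ge> - C\<^sup>2" if "x \<in> V" for x
  proof -
    have "Re (l x) \<le> C * norm (S x)"
      using bound[OF that] complex_Re_le_cmod[of "l x"] by linarith
    moreover have "0 \<le> (norm (S x) - C)\<^sup>2" by simp
    ultimately show ?thesis by (simp add: J_def power2_diff mult.commute)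
  qed
  define m where "m = Inf (J ` V)"
  have bdd: "bdd_below (J ` V)" using J_ge by (auto simp: bdd_below_def)
  have m_le: "m \<le> J x" if "x \<in> V" for x
    unfolding m_def using bdd that by (intro cInf_lower) auto
  have "\<exists>x\<in>V. J x < m + 1 / real (Suc n)" for n
  proof -
    have "Inf (J ` V) < m + 1 / real (Suc n)" by (simp add: m_def)
    thus ?thesis using cInf_lessD[of "J ` V"] V0 by blast
  qed
  then obtain X where X: "\<And>n. X n \<in> V" "\<And>n. J (X n) < m + 1 / real (Suc n)" by metis
  have J_X: "(\<lambda>n. J (X n)) \<longlonglongrightarrow> m"
  proof (rule tendsto_sandwich[where f = "\<lambda>_. m" and h = "\<lambda>n. m + 1 / real (Suc n)"])
    show "(\<lambda>n. m + 1 / real (Suc n)) \<longlonglongrightarrow> m"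
      using tendsto_add[OF tendsto_const[of m] LIMSEQ_Suc[OF lim_1_over_n[where 'a = real]]] by simp
  qed (use m_le X in \<open>auto intro!: always_eventually less_imp_le\<close>)
  \<comment> \<open>\<open>J\<close> at the midpoint is at least \<open>m\<close>; the parallelogram
    law turns this into a bound on the distance between \<open>S x\<close> and
    \<open>S z\<close>.\<close>
  have dist_le: "(norm (S x - S z))\<^sup>2 \<le> 2 * (J x - m) + 2 * (J z - m)" if "x \<in> V" "z \<in> V" for x z
  proof -
    have "m \<le> J ((1/2) *\<^sub>R (x + z))" using that by (intro m_le V_scaleR V_add)
    moreover have "(norm (S ((1/2) *\<^sub>R (x + z))))\<^sup>2 = (norm (S x + S z))\<^sup>2 / 4"
      by (simp add: S_scaleR S_add power2_eq_square)
    moreover have "(norm (S x + S z))\<^sup>2 + (norm (S x - S z))\<^sup>2 = 2 * (norm (S x))\<^sup>2 + 2 * (norm (S z))\<^sup>2"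
      by (simp add: norm_add_square norm_diff_square)
    ultimately show ?thesis
      by (simp add: J_def l_scaleR l_add field_simps)
  qed
  have "Cauchy (\<lambda>n. S (X n))"
  proof (rule metric_CauchyI)
    fix e :: real assume e: "e > 0"
    have "\<forall>\<^sub>F n in sequentially. J (X n) < m + e\<^sup>2 / 4"
      using e by (intro order_tendstoD(2)[OF J_X]) simp
    then obtain N where N: "\<And>n. n \<ge> N \<Longrightarrow> J (X n) < m + e\<^sup>2 / 4"
      by (auto simp: eventually_sequentially)
    have "dist (S (X i)) (S (X j)) < e" if "i \<ge> N" "j \<ge> N" for i j
    proof -
      have "(norm (S (X i) - S (X j)))\<^sup>2 < e\<^sup>2"
        using dist_le[OF X(1) X(1), of i j] N[OF that(1)] N[OF that(2)] by argo
      thus ?thesis using e by (simp add: dist_norm power2_less_imp_less)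
    qed
    thus "\<exists>N. \<forall>i\<ge>N. \<forall>j\<ge>N. dist (S (X i)) (S (X j)) < e" by blast
  qed
  then obtain h where h: "(\<lambda>n. S (X n)) \<longlonglongrightarrow> h"
    using Cauchy_convergent_iff convergent_def by blast
  have h_closure: "h \<in> closure (S ` V)"
    unfolding closure_sequential using h X(1) by (intro exI[of _ "\<lambda>n. S (X n)"]) auto
  \<comment> \<open>First variation: \<open>m\<close> is at most \<open>J\<close> at
    \<open>X n + s z\<close>, and letting \<open>n\<close> grow leaves a quadratic in
    \<open>s\<close> without constant term.\<close>
  have nonneg: "0 \<le> s\<^sup>2 * (norm (S z))\<^sup>2 + 2 * s * Re (cinner h (S z) - l z)" if z: "z \<in> V" for s z
  proof -
    have "(\<lambda>n. J (X n) + s\<^sup>2 * (norm (S z))\<^sup>2 + 2 * s * Re (cinner (S (X n)) (S z) - l z)) \<longlonglongrightarrow>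
      m + s\<^sup>2 * (norm (S z))\<^sup>2 + 2 * s * Re (cinner h (S z) - l z)"
      by (intro tendsto_intros J_X tendsto_Re tendsto_cinner h)
    moreover have "m \<le> J (X n) + s\<^sup>2 * (norm (S z))\<^sup>2 + 2 * s * Re (cinner (S (X n)) (S z) - l z)" for n
    proof -
      have "m \<le> J (X n + s *\<^sub>R z)" using z X(1) by (intro m_le V_add V_scaleR)
      also have "\<dots> = J (X n) + s\<^sup>2 * (norm (S z))\<^sup>2 + 2 * s * Re (cinner (S (X n)) (S z) - l z)"
        by (simp add: J_def S_add S_scaleR l_add l_scaleR norm_add_square power_mult_distrib algebra_simps)
      finally show ?thesis .
    qed
    ultimately show ?thesis
      using LIMSEQ_le_const by fastforce
  qed
  have Re_eq: "Re (cinner h (S z)) = Re (l z)" if z: "z \<in> V" for z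
  proof (rule ccontr)
    assume ne: "Re (cinner h (S z)) \<noteq> Re (l z)"
    define d where "d = Re (cinner h (S z) - l z)"
    define q where "q = (norm (S z))\<^sup>2 + 1"
    have d: "d \<noteq> 0" using ne by (simp add: d_def)
    have q: "q > 0" by (simp add: q_def add_nonneg_pos)
    have "0 \<le> (d/q)\<^sup>2 * (norm (S z))\<^sup>2 + 2 * (-(d/q)) * d"
      using nonneg[OF z, of "- (d/q)"] by (simp only: d_def[symmetric] power2_minus)
    also have "\<dots> \<le> (d/q)\<^sup>2 * q + 2 * (-(d/q)) * d"
      by (intro add_right_mono mult_left_mono) (auto simp: q_def)
    also have "\<dots> = - (d\<^sup>2 / q)"
      using q by (simp add: power2_eq_square field_simps)
    also have "\<dots> < 0" using d q by simp
    finally show False by simp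
  qed
  have "l z = cinner h (S z)" if z: "z \<in> V" for z
    using Re_eq[OF z] Re_eq[OF V_scale[OF z, of \<i>]]
    by (simp add: S_scale l_scale cinner_scaleC_right complex_eq_iff)
  thus ?thesis using that h_closure by blast
qed

text \<open>As \<open>h\<close> is only a limit of vectors of \<open>W\<close>, the test with
  \<open>h\<close> itself runs along a sequence. Hence a representing vector chosen in the closure
  of the range obeys every majorizing constant.\<close>

lemma norm_le_of_closure_range:
  fixes h :: "'b::complex_inner"
  assumes "h \<in> closure W" and bound: "\<And>z. z \<in> W \<Longrightarrow> cmod (cinner h z) \<le> C * norm z" and "C \<ge> 0"
  shows "norm h \<le> C"
proof -
  obtain z where z: "\<And>n. z n \<in> W" "z \<longlonglongrightarrow> h"
    using assms(1) by (auto simp: closure_sequential)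
  have "(\<lambda>n. cmod (cinner h (z n))) \<longlonglongrightarrow> cmod (cinner h h)" "(\<lambda>n. C * norm (z n)) \<longlonglongrightarrow> C * norm h"
    by (intro tendsto_intros tendsto_cinner z)+
  hence "cmod (cinner h h) \<le> C * norm h"
    using bound z(1) by (blast intro: LIMSEQ_le)
  hence "norm h * norm h \<le> C * norm h"
    by (simp add: cinner_self power2_eq_square norm_mult)
  thus ?thesis
    using \<open>C \<ge> 0\<close> by (cases "h = 0") auto
qed

lemma majorized_vector_representation:
  fixes S :: "'a::complex_inner \<Rightarrow> 'b::chilbert_space"
  assumes S: "bounded_clinear S" and bound: "\<And>x. cmod (cinner y x) \<le> C * norm (S x)"
  obtains h where "h \<in> closure (range S)" "\<And>x. cinner y x = cinner h (S x)"
  by (rule majorized_functional_representation[of UNIV S "cinner y" C])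
    (use bound in \<open>auto simp: csubspace_def bounded_clinear_simps[OF S] cinner_distribs\<close>)

section \<open>Adjoints of bounded operators\<close>

lemma is_adjointD: "is_adjoint A A' \<Longrightarrow> cinner (A x) y = cinner x (A' y)"
  by (simp add: is_adjoint_def)

lemma is_adjoint_sym:
  assumes "is_adjoint A A'" shows "is_adjoint A' A"
  unfolding is_adjoint_def
proof (intro allI)
  show "cinner (A' x) y = cinner x (A y)" for x y
    using arg_cong[OF is_adjointD[OF assms, of y x], of cnj] by simp
qed

lemma is_adjoint_unique:
  assumes "is_adjoint A A'" "is_adjoint A A''" shows "A' = A''"
proof (rule ext, rule cinner_ext)
  show "cinner z (A' y) = cinner z (A'' y)" for y z
    using is_adjointD[OF assms(1), of z y] is_adjointD[OF assms(2), of z y] by simp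
qed

lemma adjoint_eqI: "is_adjoint A A' \<Longrightarrow> adjoint A = A'"
  unfolding adjoint_def using is_adjoint_unique by (blast intro: some_equality)

lemma is_adjoint_adjoint:
  fixes A :: "'a::chilbert_space \<Rightarrow> 'b::complex_inner"
  assumes A: "bounded_clinear A"
  shows "is_adjoint A (adjoint A)"
proof -
  obtain K where K: "\<And>x. norm (A x) \<le> K * norm x"
    using bounded_clinear_bound[OF A] by blast
  have "\<exists>h. \<forall>x. cinner (A x) y = cinner x h" for y
  proof -
    have "cmod (cinner y (A x)) \<le> (norm y * K) * norm x" for x
      using cinner_Cauchy_Schwarz[of y "A x"] mult_left_mono[OF K[of x], of "norm y"]
      by (simp add: mult.assoc)
    hence "\<exists>h. \<forall>x. cinner y (A x) = cinner h x"
      by - (rule majorized_functional_representation[of UNIV "\<lambda>x. x" "\<lambda>x. cinner y (A x)" "norm y * K"]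
, auto simp: csubspace_def bounded_clinear_simps[OF A] cinner_distribs)
    then obtain h where h: "\<And>x. cinner y (A x) = cinner h x" by blast
    have "cinner (A x) y = cinner x h" for x
      using arg_cong[OF h[of x], of cnj] by simp
    thus ?thesis by blast
  qed
  then obtain A' where "is_adjoint A A'" unfolding is_adjoint_def by (metis (no_types))
  thus ?thesis by (simp add: adjoint_eqI)
qed

lemma is_adjoint_add: "is_adjoint A A' \<Longrightarrow> A' (x + y) = A' x + A' y"
  and is_adjoint_scaleC: "is_adjoint A A' \<Longrightarrow> A' (c *\<^sub>C x) = c *\<^sub>C A' x"
  by (rule cinner_ext, simp add: is_adjointD[of A A', symmetric] cinner_distribs)+

lemma bounded_clinear_is_adjoint:
  assumes adj: "is_adjoint A A'" and A: "bounded_clinear A"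
  shows "bounded_clinear A'"
proof -
  obtain K where "K > 0" and K: "\<And>x. norm (A x) \<le> K * norm x"
    using bounded_clinear_bound[OF A] by blast
  have "norm (A' y) \<le> K * norm y" for y
  proof -
    have "norm (A' y) * norm (A' y) = cmod (cinner (A' y) (A' y))"
      by (simp add: cinner_self power2_eq_square norm_mult)
    also have "\<dots> = cmod (cinner (A (A' y)) y)" by (simp add: is_adjointD[OF adj])
    also have "\<dots> \<le> norm (A (A' y)) * norm y" by (rule cinner_Cauchy_Schwarz)
    also have "\<dots> \<le> (K * norm (A' y)) * norm y" by (intro mult_right_mono K) simp
    finally have *: "norm (A' y) * norm (A' y) \<le> norm (A' y) * (K * norm y)" by (simp add: ac_simps)
    show ?thesis
      using * \<open>K > 0\<close> by (cases "A' y = 0") auto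
  qed
  thus ?thesis using is_adjoint_add[OF adj] is_adjoint_scaleC[OF adj] by (intro bounded_clinearI)
qed

lemma is_adjoint_shift: "is_adjoint A A' \<Longrightarrow> is_adjoint (shift A l) (shift A' (cnj l))"
  by (simp add: is_adjoint_def shift_def cinner_distribs)

lemma is_adjoint_compose:
  "is_adjoint A A' \<Longrightarrow> is_adjoint B B' \<Longrightarrow> is_adjoint (\<lambda>x. A (B x)) (\<lambda>x. B' (A' x))"
  by (simp add: is_adjoint_def)

section \<open>Orthogonal projections\<close>

definition orth_projection :: "('a::complex_inner \<Rightarrow> 'a) \<Rightarrow> bool" where
  "orth_projection P \<longleftrightarrow> bounded_clinear P \<and> is_adjoint P P \<and> (\<forall>x. P (P x) = P x)"

lemma norm_orth_projection_le:
  assumes "orth_projection P" shows "norm (P x) \<le> norm x"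
proof -
  have "norm (P x) * norm (P x) = cmod (cinner (P x) (P x))"
    by (simp add: cinner_self power2_eq_square norm_mult)
  also have "\<dots> = cmod (cinner x (P x))"
    using assms is_adjointD[of P P x "P x"] by (simp add: orth_projection_def)
  also have "\<dots> \<le> norm x * norm (P x)" by (rule cinner_Cauchy_Schwarz)
  finally show ?thesis by (cases "P x = 0") auto
qed

lemma orth_projection_complement:
  assumes "orth_projection P" shows "orth_projection (\<lambda>x. x - P x)"
  using assms unfolding orth_projection_def
  by (auto intro!: bounded_clinear_intros simp: is_adjoint_def cinner_distribs bounded_clinear_simps)

lemma orth_projection_exists:
  fixes V :: "'a::chilbert_space set"
  assumes V: "csubspace V" "closed V"
  obtains P where "orth_projection P" "\<And>x. P x \<in> V" "\<And>x. x \<in> V \<Longrightarrow> P x = x"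
proof -
  \<comment> \<open>\<open>P y\<close> will be the Riesz representative of \<open>cinner y\<close>
    restricted to \<open>V\<close>; closedness keeps it in \<open>V\<close>.\<close>
  have "\<exists>h. h \<in> V \<and> (\<forall>x\<in>V. cinner y x = cinner h x)" for y
    using V by - (rule majorized_functional_representation[of V "\<lambda>x. x" "cinner y" "norm y"],
      auto simp: cinner_distribs cinner_Cauchy_Schwarz)
  then obtain P where P: "\<And>y. P y \<in> V" "\<And>x y. x \<in> V \<Longrightarrow> cinner y x = cinner (P y) x" by metis
  have adj: "is_adjoint P P"
    unfolding is_adjoint_def
  proof (intro allI)
    fix x y
    have "cinner (P x) y = cinner (P x) (P y)"
      using arg_cong[OF P(2)[of "P x" y, OF P(1)], of cnj] by simp
    thus "cinner (P x) y = cinner x (P y)" using P(2)[of "P y" x, OF P(1)] by simp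
  qed
  have fix_V: "P x = x" if "x \<in> V" for x
  proof -
    have "(- 1) *\<^sub>C P x \<in> V"
      using P(1)[of x] V(1) unfolding csubspace_def by blast
    hence "x + (- 1) *\<^sub>C P x \<in> V"
      using that V(1) unfolding csubspace_def by blast
    hence "x - P x \<in> V"
      by (simp add: scaleC_one)
    hence "cinner (x - P x) (x - P x) = 0" using P(2)[of "x - P x" x] by (simp add: cinner_diff_left)
    thus ?thesis by (simp add: cinner_eq_zero_iff)
  qed
  have "norm (P x) \<le> 1 * norm x" for x
  proof -
    have "norm (P x) * norm (P x) = cmod (cinner (P x) (P x))"
      by (simp add: cinner_self power2_eq_square norm_mult)
    also have "\<dots> = cmod (cinner x (P x))" by (simp only: P(2)[of "P x" x, OF P(1)])
    also have "\<dots> \<le> norm x * norm (P x)" by (rule cinner_Cauchy_Schwarz)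
    finally show ?thesis by (cases "P x = 0") auto
  qed
  hence "bounded_clinear P"
    using is_adjoint_add[OF adj] is_adjoint_scaleC[OF adj] by (intro bounded_clinearI)
  thus ?thesis using that adj fix_V P(1) by (auto simp: orth_projection_def)
qed

text \<open>Invariance of the range of \<open>P\<close> under \<open>X'\<close> makes the kernel of
  \<open>P\<close> invariant under \<open>X\<close>, so the range reduces \<open>X\<close>.\<close>

lemma orth_projection_commute:
  assumes P: "orth_projection P" and adj: "is_adjoint X X'"
    and "\<And>x. P (X (P x)) = X (P x)" "\<And>x. P (X' (P x)) = X' (P x)"
  shows "P (X x) = X (P x)"
proof (rule cinner_ext)
  fix z
  have PP: "is_adjoint P P" using P by (simp add: orth_projection_def)
  note adj' = is_adjoint_sym[OF adj]
  have "cinner z (P (X x)) = cinner (P z) (X x)" by (simp add: is_adjointD[OF PP])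
  also have "\<dots> = cinner (P (X' (P z))) x" by (simp add: is_adjointD[OF adj'] assms(4))
  also have "\<dots> = cinner z (P (X (P x)))" by (simp add: is_adjointD[OF PP] is_adjointD[OF adj'])
  finally show "cinner z (P (X x)) = cinner z (X (P x))" by (simp add: assms(3))
qed

section \<open>Vectors with a global local resolvent under a dominant operator\<close>

text \<open>A solution \<open>g l\<close> of \<open>(B - l) g l = y\<close> exists for every \<open>l\<close> by majorization. Dominance puts
  \<open>y\<close> into the range of \<open>(B - l)\<^sup>*\<close> as well, which makes \<open>\<langle>y, g l\<rangle>\<close> an entire function of \<open>l\<close>
  vanishing at infinity, with leading coefficient \<open>- \<langle>y, y\<rangle>\<close> there.\<close>

lemma dominant_majorized_imp_zero:
  fixes B :: "'a::chilbert_space \<Rightarrow> 'a"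
  assumes B: "bounded_clinear B" and adj: "is_adjoint B B'"
    and dom: "\<And>l. \<exists>C. \<forall>x. norm (shift B' (cnj l) x) \<le> C * norm (shift B l x)"
    and maj: "\<And>l. \<exists>e>0. \<exists>C. \<forall>m\<in>ball l e. \<forall>x. cmod (cinner y x) \<le> C * norm (shift B' (cnj m) x)"
  shows "y = 0"
proof -
  note adj_shift = is_adjoint_shift[OF adj]
  note B' = bounded_clinear_is_adjoint[OF adj B]
  have maj_nonneg: "\<exists>e>0. \<exists>C\<ge>0. \<forall>m\<in>ball l e. \<forall>x. cmod (cinner y x) \<le> C * norm (shift B' (cnj m) x)" for l
  proof -
    obtain e C where "e > 0" and C: "\<And>m x. m \<in> ball l e \<Longrightarrow> cmod (cinner y x) \<le> C * norm (shift B' (cnj m) x)"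
      using maj[of l] by blast
    moreover have "cmod (cinner y x) \<le> max C 0 * norm (shift B' (cnj m) x)" if "m \<in> ball l e" for m x
      using C[OF that, of x] mult_right_mono[of C "max C 0" "norm (shift B' (cnj m) x)"] by simp
    ultimately show ?thesis by (intro exI[of _ e] conjI exI[of _ "max C 0"]) auto
  qed
  \<comment> \<open>Taking \<open>g\<close> in the closure of the range makes its norm at most every
    majorizing constant, so \<open>maj\<close> bounds \<open>g\<close> locally before any continuity
    is known.\<close>
  have "\<exists>g. shift B l g = y \<and>
    (\<forall>C\<ge>0. (\<forall>x. cmod (cinner y x) \<le> C * norm (shift B' (cnj l) x)) \<longrightarrow> norm g \<le> C)" for l
  proof -
    obtain C where C: "\<And>x. cmod (cinner y x) \<le> C * norm (shift B' (cnj l) x)"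
      using maj[of l] centre_in_ball by blast
    note S = bounded_clinear_shift[OF B', of "cnj l"]
    obtain g where g: "g \<in> closure (range (shift B' (cnj l)))"
      and rep: "\<And>x. cinner y x = cinner g (shift B' (cnj l) x)"
      using majorized_vector_representation[OF S C] by blast
    have "shift B l g = y"
    proof (rule cinner_ext)
      fix z
      show "cinner z (shift B l g) = cinner z y"
        using arg_cong[OF rep[of z], of cnj] is_adjointD[OF is_adjoint_sym[OF adj_shift], of l z g]
        by simp
    qed
    moreover have "norm g \<le> C'" if "C' \<ge> 0" "\<And>x. cmod (cinner y x) \<le> C' * norm (shift B' (cnj l) x)" for C'
      using g that by (intro norm_le_of_closure_range[OF g]) (auto simp: rep)
    ultimately show ?thesis by blast
  qed
  then obtain g where g: "\<And>l. shift B l (g l) = y"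
    and g_le: "\<And>l C. C \<ge> 0 \<Longrightarrow> (\<And>x. cmod (cinner y x) \<le> C * norm (shift B' (cnj l) x)) \<Longrightarrow> norm (g l) \<le> C"
    by metis
  define \<psi> where "\<psi> l = cinner y (g l)" for l
  have deriv: "\<exists>D. (\<psi> has_field_derivative D) (at l)" for l
  proof -
    obtain C where C: "\<And>x. norm (shift B' (cnj l) x) \<le> C * norm (shift B l x)"
      using dom by blast
    obtain e Cb where e: "e > 0" and Cb: "Cb \<ge> 0" and "\<And>m x. m \<in> ball l e \<Longrightarrow> cmod (cinner y x) \<le> Cb * norm (shift B' (cnj m) x)"
      using maj_nonneg[of l] by blast
    hence g_Cb: "norm (g m) \<le> Cb" if "m \<in> ball l e" for m
      using that by (intro g_le)
    note S = bounded_clinear_shift[OF B, of l]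
    \<comment> \<open>Dominance also majorizes \<open>y\<close> by \<open>shift B l\<close>. So
      \<open>y\<close> is the image of some \<open>h\<close> under the adjoint of
      \<open>shift B l\<close>, and the difference quotients of \<open>\<psi>\<close> become
      \<open>cinner h (g m)\<close>.\<close>
    have "cmod (cinner y x) \<le> (norm (g l) * C) * norm (shift B l x)" for x
    proof -
      have "cinner y x = cinner (g l) (shift B' (cnj l) x)"
        by (metis g is_adjointD[OF adj_shift])
      thus ?thesis
        using cinner_Cauchy_Schwarz[of "g l" "shift B' (cnj l) x"]
          mult_left_mono[OF C[of x], of "norm (g l)"] by (simp add: mult.assoc)
    qed
    then obtain h where h: "h \<in> closure (range (shift B l))"
      and rep: "\<And>x. cinner y x = cinner h (shift B l x)"
      using majorized_vector_representation[OF S] by blast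
    have shift_diff: "shift B l (g m - g l) = (m - l) *\<^sub>C g m" for m
    proof -
      have "shift B l (g m) = y + (m - l) *\<^sub>C g m"
        using g[of m] by (auto simp: shift_def scaleC_distribs)
      thus ?thesis by (simp add: bounded_clinear_simps[OF S] g)
    qed
    have quotient: "(\<psi> m - \<psi> l) / (m - l) = cinner h (g m)" if "m \<noteq> l" for m
    proof -
      have "\<psi> m - \<psi> l = cinner y (g m - g l)"
        by (simp add: \<psi>_def cinner_diff_right)
      also have "\<dots> = (m - l) * cinner h (g m)"
        by (simp only: rep shift_diff cinner_scaleC_right)
      finally show ?thesis using that by simp
    qed
    have "((\<lambda>m. cinner h (g m)) \<longlongrightarrow> cinner h (g l)) (at l)"
    proof (rule tendstoI)
      fix \<epsilon> :: real assume \<epsilon>: "\<epsilon> > 0"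
      have "\<epsilon> / (4 * (Cb + 1)) > 0" using \<epsilon> Cb by simp
      then obtain k where k: "dist (shift B l k) h < \<epsilon> / (4 * (Cb + 1))"
        using h by (auto simp: closure_approachable)
      define L where "L = norm k * \<bar>C\<bar> * Cb + 1"
      have L: "L > 0" using Cb by (simp add: L_def add_nonneg_pos)
      define d where "d = min e (\<epsilon> / (2 * L))"
      have d: "d > 0" using e \<epsilon> L by (simp add: d_def)
      have "dist (cinner h (g m)) (cinner h (g l)) < \<epsilon>" if m: "dist m l < d" for m
      proof -
        let ?u = "g m - g l"
        have m': "m \<in> ball l e" using m by (simp add: d_def dist_commute)
        have u: "norm ?u \<le> 2 * Cb"
          using norm_triangle_ineq4[of "g m" "g l"] g_Cb[OF m'] g_Cb[of l] e by simp
        have "cmod (cinner (h - shift B l k) ?u) \<le> norm (h - shift B l k) * norm ?u"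
          by (rule cinner_Cauchy_Schwarz)
        also have "\<dots> \<le> (\<epsilon> / (4 * (Cb + 1))) * (2 * Cb)"
          using k u \<epsilon> Cb by (intro mult_mono) (auto simp: dist_norm norm_minus_commute)
        also have "\<dots> < \<epsilon> / 2" using \<epsilon> Cb by (simp add: field_simps)
        finally have 1: "cmod (cinner (h - shift B l k) ?u) < \<epsilon> / 2" .
        have "cmod (cinner (shift B l k) ?u) \<le> norm k * norm (shift B' (cnj l) ?u)"
          unfolding is_adjointD[OF adj_shift] by (rule cinner_Cauchy_Schwarz)
        also have "\<dots> \<le> norm k * (\<bar>C\<bar> * norm (shift B l ?u))"
          using C[of ?u] mult_right_mono[OF abs_ge_self[of C], of "norm (shift B l ?u)"]
          by (intro mult_left_mono) auto
        also have "\<dots> = (norm k * \<bar>C\<bar> * norm (g m)) * dist m l"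
          by (simp add: shift_diff norm_scaleC dist_norm)
        also have "\<dots> \<le> L * dist m l"
          using g_Cb[OF m'] by (intro mult_right_mono) (auto simp: L_def intro!: mult_left_mono add_increasing2)
        also have "\<dots> < L * (\<epsilon> / (2 * L))"
          using m L by (intro mult_strict_left_mono) (auto simp: d_def)
        also have "\<dots> = \<epsilon> / 2" using L by simp
        finally have 2: "cmod (cinner (shift B l k) ?u) < \<epsilon> / 2" .
        have "cinner h (g m) - cinner h (g l) = cinner (h - shift B l k) ?u + cinner (shift B l k) ?u"
          by (simp add: cinner_distribs)
        thus ?thesis
          using 1 2 norm_triangle_ineq[of "cinner (h - shift B l k) ?u" "cinner (shift B l k) ?u"]
          by (simp add: dist_norm)
      qed
      thus "\<forall>\<^sub>F m in at l. dist (cinner h (g m)) (cinner h (g l)) < \<epsilon>"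
        using d by (auto simp: eventually_at)
    qed
    hence "((\<lambda>m. (\<psi> m - \<psi> l) / (m - l)) \<longlongrightarrow> cinner h (g l)) (at l)"
      by (rule Lim_transform_eventually) (auto simp: eventually_at quotient intro!: exI[of _ 1])
    thus ?thesis using has_field_derivative_iff by blast
  qed
  obtain K where K: "K > 0" "\<And>x. norm (B x) \<le> K * norm x"
    using bounded_clinear_bound[OF B] by blast
  have g_lim: "((\<lambda>l. norm (g l)) \<longlongrightarrow> 0) at_infinity"
  proof (rule Lim_null_comparison)
    have "norm (g l) \<le> norm y / (norm l - K)" if "norm l > K" for l
    proof -
      have "norm (l *\<^sub>C g l) \<le> norm (B (g l)) + norm y"
        using norm_triangle_ineq4[of "B (g l)" y] g[of l] by (simp add: shift_def algebra_simps)
      hence "norm l * norm (g l) \<le> K * norm (g l) + norm y"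
        using K(2)[of "g l"] by (simp add: norm_scaleC)
      thus ?thesis using that by (simp add: field_simps)
    qed
    thus "\<forall>\<^sub>F l in at_infinity. norm (norm (g l)) \<le> norm y / (norm l - K)"
      unfolding eventually_at_infinity by (intro exI[of _ "K + 1"]) auto
    have "filterlim (\<lambda>l::complex. - K + norm l) at_top at_infinity"
      by (intro filterlim_tendsto_add_at_top[OF tendsto_const] filterlim_norm_at_top)
    thus "((\<lambda>l::complex. norm y / (norm l - K)) \<longlongrightarrow> 0) at_infinity"
      by (intro real_tendsto_divide_at_top[OF tendsto_const]) simp
  qed
  have \<psi>_zero: "\<psi> l = 0" for l
  proof (rule Liouville_weak_0[of \<psi>])
    show "\<psi> holomorphic_on UNIV"
      using deriv by (auto simp: holomorphic_on_def field_differentiable_def)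
    have "((\<lambda>l. norm y * norm (g l)) \<longlongrightarrow> 0) at_infinity"
      using tendsto_mult_left[OF g_lim, of "norm y"] by simp
    thus "(\<psi> \<longlongrightarrow> 0) at_infinity"
      by (rule Lim_null_comparison[rotated]) (simp add: \<psi>_def cinner_Cauchy_Schwarz)
  qed
  \<comment> \<open>With \<open>\<psi> = 0\<close> the equation for \<open>g l\<close> makes this
    product constant in \<open>l\<close>, although it tends to 0 at infinity.\<close>
  have "cinner y (B (g l)) = cinner y y" for l
    using arg_cong[OF g[of l], of "cinner y"] \<psi>_zero[of l]
    by (simp add: shift_def cinner_distribs \<psi>_def)
  moreover have "((\<lambda>l. cinner y (B (g l))) \<longlongrightarrow> 0) at_infinity"
  proof (rule Lim_null_comparison)
    show "((\<lambda>l. (norm y * K) * norm (g l)) \<longlongrightarrow> 0) at_infinity"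
      using tendsto_mult_left[OF g_lim, of "norm y * K"] by simp
    have "cmod (cinner y (B (g l))) \<le> norm y * K * norm (g l)" for l
      using cinner_Cauchy_Schwarz[of y "B (g l)"] mult_left_mono[OF K(2)[of "g l"], of "norm y"]
      by (simp add: mult.assoc)
    thus "\<forall>\<^sub>F l in at_infinity. norm (cinner y (B (g l))) \<le> norm y * K * norm (g l)" by simp
  qed
  ultimately have "cinner y y = 0"
    by (simp add: tendsto_const_iff trivial_limit_at_infinity)
  thus "y = 0" by (simp add: cinner_eq_zero_iff)
qed

section \<open>Spectral projections of normal operators\<close>

lemma commute_adjoint:
  assumes X: "is_adjoint X X'" and Q: "is_adjoint Q Q" and comm: "\<And>x. X (Q x) = Q (X x)"
  shows "X' (Q x) = Q (X' x)"
proof (rule cinner_ext)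
  fix z
  show "cinner z (X' (Q x)) = cinner z (Q (X' x))"
    by (simp add: is_adjointD[OF X, symmetric] is_adjointD[OF Q, symmetric] comm)
qed

section \<open>Polynomials in a contraction and the operator square root\<close>

inductive nonneg_poly :: "('a::complex_inner \<Rightarrow> 'a) \<Rightarrow> ('a \<Rightarrow> 'a) \<Rightarrow> real \<Rightarrow> bool" for Z where
  zero: "nonneg_poly Z (\<lambda>x. 0) 0"
| var: "nonneg_poly Z Z 1"
| add: "nonneg_poly Z F a \<Longrightarrow> nonneg_poly Z G b \<Longrightarrow> nonneg_poly Z (\<lambda>x. F x + G x) (a + b)"
| mult: "nonneg_poly Z F a \<Longrightarrow> nonneg_poly Z G b \<Longrightarrow> nonneg_poly Z (\<lambda>x. F (G x)) (a * b)"
| scale: "r \<ge> 0 \<Longrightarrow> nonneg_poly Z F a \<Longrightarrow> nonneg_poly Z (\<lambda>x. r *\<^sub>R F x) (r * a)"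

text \<open>\<open>F\<close> is a polynomial in \<open>Z\<close> with nonnegative coefficients and
  no constant term, and \<open>a\<close> is its value at 1; the triangle inequality therefore gives
  the bound \<open>a\<close>.\<close>

lemma nonneg_poly_bounded:
  assumes "nonneg_poly Z F a" and Z: "bounded_clinear Z" "\<And>x. norm (Z x) \<le> norm x"
  shows "a \<ge> 0 \<and> bounded_clinear F \<and> (\<forall>x. norm (F x) \<le> a * norm x)"
  using assms(1)
proof induction
  case (add F a G b)
  have "norm (F x + G x) \<le> (a + b) * norm x" for x
    using norm_triangle_ineq[of "F x" "G x"] add.IH by (fastforce simp: distrib_right intro: order_trans add_mono)
  then show ?case using add by (simp add: bounded_clinear_plus)
next
  case (mult F a G b)
  have "norm (F (G x)) \<le> (a * b) * norm x" for x
  proof -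
    have "norm (F (G x)) \<le> a * norm (G x)" using mult by blast
    also have "\<dots> \<le> a * (b * norm x)" using mult by (intro mult_left_mono) auto
    finally show ?thesis by simp
  qed
  then show ?case using mult by (simp add: bounded_clinear_compose)
next
  case (scale r F a)
  then show ?case by (simp add: bounded_clinear_scaleR_fun mult_left_mono mult.assoc)
qed (use Z in \<open>auto simp: bounded_clinear_const_zero\<close>)

lemma nonneg_poly_commute:
  assumes "nonneg_poly Z F a" and X: "bounded_clinear X" "\<And>x. X (Z x) = Z (X x)"
  shows "X (F x) = F (X x)"
  using assms(1) by (induction arbitrary: x) (simp_all add: bounded_clinear_simps[OF X(1)] X(2))

lemma nonneg_poly_commute_poly:
  assumes F: "nonneg_poly Z F a" and G: "nonneg_poly Z G b"
    and Z: "bounded_clinear Z" "\<And>x. norm (Z x) \<le> norm x"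
  shows "F (G x) = G (F x)"
proof (rule nonneg_poly_commute[OF G])
  show "bounded_clinear F" using nonneg_poly_bounded[OF F Z] by blast
  show "F (Z x) = Z (F x)" for x using nonneg_poly_commute[OF F Z(1)] by simp
qed

lemma nonneg_poly_selfadjoint:
  assumes "nonneg_poly Z F a" and Z: "bounded_clinear Z" "\<And>x. norm (Z x) \<le> norm x"
    and Z_adj: "is_adjoint Z Z"
  shows "is_adjoint F F"
  using assms(1)
proof induction
  case (mult F a G b)
  show ?case
    using is_adjoint_compose[OF mult.IH] nonneg_poly_commute_poly[OF mult.hyps Z] by simp
qed (use Z_adj in \<open>simp_all add: is_adjoint_def cinner_distribs\<close>)

text \<open>With \<open>Z = 1 - P\<close> the iteration \<open>Y \<leftarrow> (Z + Y\<^sup>2) / 2\<close> tends to \<open>1 - P\<^sup>1\<^sup>/\<^sup>2\<close>. All iterates and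
  their increments are polynomials in \<open>Z\<close> with nonnegative coefficients, so that for a
  contraction \<open>Z\<close> the scalar iteration at \<open>Z = 1\<close> controls the convergence in norm.\<close>

primrec sqrt_iter :: "('a::complex_inner \<Rightarrow> 'a) \<Rightarrow> nat \<Rightarrow> 'a \<Rightarrow> 'a" where
  "sqrt_iter Z 0 = (\<lambda>x. 0)"
| "sqrt_iter Z (Suc n) = (\<lambda>x. (1/2) *\<^sub>R (Z x + sqrt_iter Z n (sqrt_iter Z n x)))"

primrec sqrt_iter_one :: "nat \<Rightarrow> real" where
  "sqrt_iter_one 0 = 0"
| "sqrt_iter_one (Suc n) = (1/2) * (1 + sqrt_iter_one n * sqrt_iter_one n)"

lemma nonneg_poly_sqrt_iter: "nonneg_poly Z (sqrt_iter Z n) (sqrt_iter_one n)"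
proof (induction n)
  case (Suc n)
  have "nonneg_poly Z (\<lambda>x. (1/2) *\<^sub>R (Z x + sqrt_iter Z n (sqrt_iter Z n x)))
    ((1/2) * (1 + sqrt_iter_one n * sqrt_iter_one n))"
    by (rule nonneg_poly.scale, simp, rule nonneg_poly.add[OF nonneg_poly.var nonneg_poly.mult[OF Suc Suc]])
  then show ?case by simp
qed (simp add: nonneg_poly.zero)

text \<open>Subtraction may spoil nonnegativity. But the iterates commute, so each increment is half
  the previous increment times the sum of the two iterates, and only sums and products are
  needed.\<close>

lemma nonneg_poly_sqrt_iter_diff:
  assumes Z: "bounded_clinear Z" "\<And>x. norm (Z x) \<le> norm x"
  shows "nonneg_poly Z (\<lambda>x. sqrt_iter Z (Suc n) x - sqrt_iter Z n x)
    (sqrt_iter_one (Suc n) - sqrt_iter_one n)"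
proof (induction n)
  case 0
  show ?case
    using nonneg_poly.scale[of "1/2", OF _ nonneg_poly.var[of Z]] by simp
next
  case (Suc n)
  let ?Y = "sqrt_iter Z n" and ?Y' = "sqrt_iter Z (Suc n)"
  let ?y = "sqrt_iter_one n" and ?y' = "sqrt_iter_one (Suc n)"
  have lin: "bounded_clinear (sqrt_iter Z m)" for m
    using nonneg_poly_bounded[OF nonneg_poly_sqrt_iter Z] by blast
  have comm: "?Y (?Y' x) = ?Y' (?Y x)" for x
    by (rule nonneg_poly_commute_poly[OF nonneg_poly_sqrt_iter nonneg_poly_sqrt_iter Z])
  have "nonneg_poly Z (\<lambda>x. (1/2) *\<^sub>R (?Y' (?Y' x + ?Y x) - ?Y (?Y' x + ?Y x)))
    ((1/2) * ((?y' - ?y) * (?y' + ?y)))"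
    by (rule nonneg_poly.scale, simp, rule nonneg_poly.mult[OF Suc nonneg_poly.add])
      (rule nonneg_poly_sqrt_iter)+
  moreover have "(1/2) *\<^sub>R (?Y' (?Y' x + ?Y x) - ?Y (?Y' x + ?Y x)) =
      sqrt_iter Z (Suc (Suc n)) x - ?Y' x" for x
  proof -
    have "?Y' (?Y' x + ?Y x) - ?Y (?Y' x + ?Y x) = ?Y' (?Y' x) - ?Y (?Y x)"
      by (simp only: bounded_clinear_add[OF lin] comm) simp
    moreover have "sqrt_iter Z (Suc (Suc n)) x = (1/2) *\<^sub>R (Z x + ?Y' (?Y' x))"
      and "?Y' x = (1/2) *\<^sub>R (Z x + ?Y (?Y x))" by simp_all
    ultimately show ?thesis by (simp only: scaleR_diff_right[symmetric]) simp
  qed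
  moreover have "(1/2) * ((?y' - ?y) * (?y' + ?y)) = sqrt_iter_one (Suc (Suc n)) - ?y'"
  proof -
    have "sqrt_iter_one (Suc (Suc n)) = (1/2) * (1 + ?y' * ?y')" and "?y' = (1/2) * (1 + ?y * ?y)"
      by simp_all
    thus ?thesis by algebra
  qed
  ultimately show ?case by (simp only:)
qed

lemma sqrt_iter_one_le: "0 \<le> sqrt_iter_one n \<and> sqrt_iter_one n \<le> 1"
proof (induction n)
  case (Suc n)
  hence "sqrt_iter_one n * sqrt_iter_one n \<le> 1 * 1" by (intro mult_mono) auto
  thus ?case by simp
qed simp

lemma sqrt_iter_one_incseq: "incseq sqrt_iter_one"
proof (rule incseq_SucI)
  fix n
  have "0 \<le> (1 - sqrt_iter_one n)\<^sup>2" by simp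
  thus "sqrt_iter_one n \<le> sqrt_iter_one (Suc n)" by (simp add: power2_eq_square algebra_simps)
qed

lemma norm_sqrt_iter_diff:
  assumes Z: "bounded_clinear Z" "\<And>x. norm (Z x) \<le> norm x" and "n \<le> m"
  shows "norm (sqrt_iter Z m x - sqrt_iter Z n x) \<le> (sqrt_iter_one m - sqrt_iter_one n) * norm x"
  using \<open>n \<le> m\<close>
proof (induction m rule: dec_induct)
  case (step m)
  have "norm (sqrt_iter Z (Suc m) x - sqrt_iter Z m x) \<le>
      (sqrt_iter_one (Suc m) - sqrt_iter_one m) * norm x"
    using nonneg_poly_bounded[OF nonneg_poly_sqrt_iter_diff[OF Z] Z] by blast
  moreover have "norm (sqrt_iter Z (Suc m) x - sqrt_iter Z n x) \<le>
      norm (sqrt_iter Z (Suc m) x - sqrt_iter Z m x) + norm (sqrt_iter Z m x - sqrt_iter Z n x)"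
    using norm_triangle_ineq[of "sqrt_iter Z (Suc m) x - sqrt_iter Z m x" "sqrt_iter Z m x - sqrt_iter Z n x"] by simp
  ultimately show ?case using step.IH by (simp only: left_diff_distrib)
qed simp

lemma sqrt_iter_converges:
  fixes Z :: "'a::chilbert_space \<Rightarrow> 'a"
  assumes Z: "bounded_clinear Z" "\<And>x. norm (Z x) \<le> norm x"
  shows "convergent (\<lambda>n. sqrt_iter Z n x)"
proof -
  obtain l where "sqrt_iter_one \<longlonglongrightarrow> l"
    using incseq_convergent[OF sqrt_iter_one_incseq, of 1] sqrt_iter_one_le by blast
  hence Cauchy: "Cauchy sqrt_iter_one" by (rule LIMSEQ_imp_Cauchy)
  have "Cauchy (\<lambda>n. sqrt_iter Z n x)"
  proof (rule metric_CauchyI)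
    fix e :: real assume e: "e > 0"
    have "e / (norm x + 1) > 0" using e by (simp add: add_nonneg_pos)
    then obtain N where N: "\<And>m n. m \<ge> N \<Longrightarrow> n \<ge> N \<Longrightarrow> dist (sqrt_iter_one m) (sqrt_iter_one n) < e / (norm x + 1)"
      using Cauchy unfolding Cauchy_def by blast
    have less: "dist (sqrt_iter Z m x) (sqrt_iter Z n x) < e" if "n \<ge> N" "m \<ge> n" for m n
    proof -
      have "dist (sqrt_iter Z m x) (sqrt_iter Z n x) \<le> (sqrt_iter_one m - sqrt_iter_one n) * norm x"
        unfolding dist_norm by (rule norm_sqrt_iter_diff[OF Z that(2)])
      also have "\<dots> \<le> dist (sqrt_iter_one m) (sqrt_iter_one n) * (norm x + 1)"
        by (intro mult_mono) (auto simp: dist_real_def)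
      also have "\<dots> < e / (norm x + 1) * (norm x + 1)"
        using N[of m n] that by (intro mult_strict_right_mono) (auto simp: add_nonneg_pos)
      also have "\<dots> = e" by (simp add: add_nonneg_eq_0_iff)
      finally show ?thesis .
    qed
    have "dist (sqrt_iter Z m x) (sqrt_iter Z n x) < e" if "m \<ge> N" "n \<ge> N" for m n
      using less[of n m] less[of m n] that by (cases "n \<le> m") (auto simp: dist_commute)
    thus "\<exists>N. \<forall>m\<ge>N. \<forall>n\<ge>N. dist (sqrt_iter Z m x) (sqrt_iter Z n x) < e" by blast
  qed
  thus ?thesis by (simp add: Cauchy_convergent_iff)
qed

lemma contraction_sqrt_fixpoint:
  fixes Z :: "'a::chilbert_space \<Rightarrow> 'a"
  assumes Z: "bounded_clinear Z" "\<And>x. norm (Z x) \<le> norm x" and Z_adj: "is_adjoint Z Z"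
  obtains Y where "bounded_clinear Y" "is_adjoint Y Y" "\<And>x. norm (Y x) \<le> norm x"
    "\<And>x. 2 *\<^sub>R Y x = Z x + Y (Y x)"
    "\<And>X x. bounded_clinear X \<Longrightarrow> (\<And>x. X (Z x) = Z (X x)) \<Longrightarrow> X (Y x) = Y (X x)"
proof -
  let ?Y = "sqrt_iter Z"
  define Y where "Y x = lim (\<lambda>n. ?Y n x)" for x
  have lim: "(\<lambda>n. ?Y n x) \<longlonglongrightarrow> Y x" for x
    using sqrt_iter_converges[OF Z] unfolding Y_def by (simp add: convergent_LIMSEQ_iff)
  have lin: "bounded_clinear (?Y n)" for n
    using nonneg_poly_bounded[OF nonneg_poly_sqrt_iter Z] by blast
  have adj: "is_adjoint (?Y n) (?Y n)" for n
    by (rule nonneg_poly_selfadjoint[OF nonneg_poly_sqrt_iter Z Z_adj])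
  have norm_iter: "norm (?Y n x) \<le> norm x" for n x
  proof -
    have "norm (?Y n x) \<le> sqrt_iter_one n * norm x"
      using nonneg_poly_bounded[OF nonneg_poly_sqrt_iter Z] by blast
    also have "\<dots> \<le> 1 * norm x" using sqrt_iter_one_le by (intro mult_right_mono) auto
    finally show ?thesis by simp
  qed
  have Y_adj: "is_adjoint Y Y"
    unfolding is_adjoint_def
  proof (intro allI)
    fix x y
    have "(\<lambda>n. cinner (?Y n x) y) \<longlonglongrightarrow> cinner (Y x) y" "(\<lambda>n. cinner x (?Y n y)) \<longlonglongrightarrow> cinner x (Y y)"
      by (intro tendsto_cinner tendsto_const lim)+
    thus "cinner (Y x) y = cinner x (Y y)"
      using LIMSEQ_unique by (simp add: is_adjointD[OF adj])
  qed
  have Y_norm: "norm (Y x) \<le> norm x" for x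
    by (rule LIMSEQ_le_const2[OF tendsto_norm[OF lim]]) (use norm_iter in blast)
  have Y_lin: "bounded_clinear Y"
    using is_adjoint_add[OF Y_adj] is_adjoint_scaleC[OF Y_adj] Y_norm
    by (intro bounded_clinearI[where K = 1]) auto
  \<comment> \<open>Pointwise convergence passes to the square because all iterates are
    contractions.\<close>
  have YY: "(\<lambda>n. ?Y n (?Y n x)) \<longlonglongrightarrow> Y (Y x)" for x
  proof (rule LIM_zero_cancel, rule Lim_null_comparison)
    have "norm (?Y n (?Y n x) - Y (Y x)) \<le> norm (?Y n x - Y x) + norm (?Y n (Y x) - Y (Y x))" for n
    proof -
      have eq: "?Y n (?Y n x) - Y (Y x) = ?Y n (?Y n x - Y x) + (?Y n (Y x) - Y (Y x))"
        by (simp add: bounded_clinear_diff[OF lin])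
      show ?thesis
        unfolding eq by (rule order_trans[OF norm_triangle_ineq add_right_mono[OF norm_iter]])
    qed
    thus "\<forall>\<^sub>F n in sequentially. norm (?Y n (?Y n x) - Y (Y x)) \<le>
        norm (?Y n x - Y x) + norm (?Y n (Y x) - Y (Y x))" by simp
    show "(\<lambda>n. norm (?Y n x - Y x) + norm (?Y n (Y x) - Y (Y x))) \<longlonglongrightarrow> 0"
      by (intro tendsto_add_zero tendsto_norm_zero LIM_zero lim)
  qed
  have Y_fix: "2 *\<^sub>R Y x = Z x + Y (Y x)" for x
  proof -
    have "(\<lambda>n. 2 *\<^sub>R ?Y (Suc n) x) \<longlonglongrightarrow> 2 *\<^sub>R Y x"
      by (intro tendsto_intros LIMSEQ_Suc lim)
    moreover have "(\<lambda>n. 2 *\<^sub>R ?Y (Suc n) x) \<longlonglongrightarrow> Z x + Y (Y x)"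
      using tendsto_add[OF tendsto_const YY, of "Z x"] by simp
    ultimately show ?thesis by (rule LIMSEQ_unique)
  qed
  have comm: "X (Y x) = Y (X x)" if X: "bounded_clinear X" and "\<And>x. X (Z x) = Z (X x)" for X x
  proof -
    have "(\<lambda>n. X (?Y n x)) \<longlonglongrightarrow> X (Y x)"
      by (rule bounded_linear.tendsto[OF bounded_clinear_imp_bounded_linear[OF X] lim])
    moreover have "(\<lambda>n. X (?Y n x)) = (\<lambda>n. ?Y n (X x))"
      using nonneg_poly_commute[OF nonneg_poly_sqrt_iter[of Z] that] by blast
    ultimately show ?thesis using lim LIMSEQ_unique by metis
  qed
  show ?thesis using that Y_lin Y_adj Y_norm Y_fix comm by blast
qed

section \<open>Modulus and spectral splitting of a self-adjoint operator\<close>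

lemma selfadjoint_modulus:
  fixes Q :: "'a::chilbert_space \<Rightarrow> 'a"
  assumes Q: "bounded_clinear Q" and adj: "is_adjoint Q Q"
  obtains J where "bounded_clinear J" "is_adjoint J J" "\<And>x. J (J x) = Q (Q x)"
    "\<And>x. 0 \<le> Re (cinner (J x) x)"
    "\<And>X x. bounded_clinear X \<Longrightarrow> (\<And>x. X (Q x) = Q (X x)) \<Longrightarrow> X (J x) = J (X x)"
proof -
  obtain K where K: "K > 0" "\<And>x. norm (Q x) \<le> K * norm x"
    using bounded_clinear_bound[OF Q] by blast
  \<comment> \<open>The fixpoint \<open>Y\<close> for this contraction satisfies
    \<open>(1 - Y)\<^sup>2 = 1 - Z = (Q / K)\<^sup>2\<close>, so \<open>K (1 - Y)\<close> is the
    modulus; it is positive because \<open>Y\<close> is a contraction.\<close>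
  define Z where "Z x = x - (1/K\<^sup>2) *\<^sub>R Q (Q x)" for x
  have Z: "bounded_clinear Z"
    unfolding Z_def
    by (intro bounded_clinear_minus_fun bounded_clinear_id bounded_clinear_scaleR_fun bounded_clinear_compose[OF Q Q])
  have Z_norm: "norm (Z x) \<le> norm x" for x
  proof -
    have "cinner x (Q (Q x)) = cinner (Q x) (Q x)" by (simp add: is_adjointD[OF adj])
    hence "(norm (Z x))\<^sup>2 = (norm x)\<^sup>2 - 2 / K\<^sup>2 * (norm (Q x))\<^sup>2 + (norm (Q (Q x)) / K\<^sup>2)\<^sup>2"
      by (simp add: Z_def norm_diff_square cinner_self power_divide)
    moreover have "(norm (Q (Q x)) / K\<^sup>2)\<^sup>2 \<le> (norm (Q x) / K)\<^sup>2"
      using K(2)[of "Q x"] K(1) by (intro power_mono) (auto simp: field_simps power2_eq_square)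
    moreover have "(norm (Q x) / K)\<^sup>2 = 1 / K\<^sup>2 * (norm (Q x))\<^sup>2"
      by (simp add: power_divide)
    moreover have "0 \<le> 1 / K\<^sup>2 * (norm (Q x))\<^sup>2" by simp
    ultimately have "(norm (Z x))\<^sup>2 \<le> (norm x)\<^sup>2" by linarith
    thus ?thesis by (meson norm_ge_zero power2_le_imp_le)
  qed
  have Z_adj: "is_adjoint Z Z"
    by (simp add: is_adjoint_def Z_def cinner_distribs is_adjointD[OF adj])
  obtain Y where Y: "bounded_clinear Y" "is_adjoint Y Y" "\<And>x. norm (Y x) \<le> norm x"
    and Y_fix: "\<And>x. 2 *\<^sub>R Y x = Z x + Y (Y x)"
    and Y_comm: "\<And>X x. bounded_clinear X \<Longrightarrow> (\<And>x. X (Z x) = Z (X x)) \<Longrightarrow> X (Y x) = Y (X x)"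
    using contraction_sqrt_fixpoint[OF Z Z_norm Z_adj] by blast
  define J where "J x = K *\<^sub>R (x - Y x)" for x
  show ?thesis
  proof (rule that)
    show J: "bounded_clinear J"
      unfolding J_def by (intro bounded_clinear_minus_fun bounded_clinear_id bounded_clinear_scaleR_fun Y)
    show "is_adjoint J J"
      by (simp add: is_adjoint_def J_def cinner_distribs is_adjointD[OF Y(2)])
    show "J (J x) = Q (Q x)" for x
    proof -
      have "J (J x) = K\<^sup>2 *\<^sub>R (x - 2 *\<^sub>R Y x + Y (Y x))"
        by (simp add: J_def bounded_clinear_simps[OF Y(1)] power2_eq_square algebra_simps scaleR_2)
      also have "x - 2 *\<^sub>R Y x + Y (Y x) = x - Z x" by (simp add: Y_fix)
      also have "K\<^sup>2 *\<^sub>R (x - Z x) = Q (Q x)" using K(1) by (simp add: Z_def)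
      finally show ?thesis .
    qed
    show "0 \<le> Re (cinner (J x) x)" for x
    proof -
      have "Re (cinner (Y x) x) \<le> norm (Y x) * norm x"
        using complex_Re_le_cmod cinner_Cauchy_Schwarz order_trans by blast
      also have "\<dots> \<le> norm x * norm x" using Y(3) by (intro mult_right_mono) auto
      finally show ?thesis
        using K(1) by (simp add: J_def cinner_distribs cinner_self power2_eq_square)
    qed
    show "X (J x) = J (X x)" if X: "bounded_clinear X" and comm: "\<And>x. X (Q x) = Q (X x)" for X x
    proof -
      have "X (Y x) = Y (X x)"
        by (rule Y_comm[OF X]) (simp add: Z_def bounded_clinear_simps[OF X] comm)
      thus ?thesis by (simp add: J_def bounded_clinear_simps[OF X])
    qed
  qed
qed

text \<open>\<open>P\<close> projects onto the kernel of \<open>J - Q\<close>, where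
  \<open>J\<close> is the modulus of \<open>Q\<close>. As \<open>J\<close> and \<open>Q\<close>
  commute and have equal squares, the range of \<open>J + Q\<close> lies in this kernel. So the
  self-adjoint \<open>J + Q\<close> vanishes on the orthogonal complement, where
  \<open>Q = - J\<close>.\<close>

lemma selfadjoint_spectral_cut:
  fixes Q :: "'a::chilbert_space \<Rightarrow> 'a"
  assumes Q: "bounded_clinear Q" and adj: "is_adjoint Q Q"
  obtains P where "orth_projection P"
    "\<And>x. 0 \<le> Re (cinner (Q (P x)) (P x))" "\<And>x. Re (cinner (Q (x - P x)) (x - P x)) \<le> 0"
    "\<And>X X' x. bounded_clinear X \<Longrightarrow> is_adjoint X X' \<Longrightarrow> (\<And>x. X (Q x) = Q (X x)) \<Longrightarrow> P (X x) = X (P x)"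
proof -
  obtain J where J: "bounded_clinear J" "is_adjoint J J" and J_sq: "\<And>x. J (J x) = Q (Q x)"
    and J_pos: "\<And>x. 0 \<le> Re (cinner (J x) x)"
    and J_comm: "\<And>X x. bounded_clinear X \<Longrightarrow> (\<And>x. X (Q x) = Q (X x)) \<Longrightarrow> X (J x) = J (X x)"
    using selfadjoint_modulus[OF assms] by blast
  define V where "V = {x. J x = Q x}"
  have "csubspace V"
    by (simp add: csubspace_def V_def bounded_clinear_simps[OF J(1)] bounded_clinear_simps[OF Q])
  moreover have "closed V"
    unfolding V_def by (intro closed_Collect_eq continuous_on_bounded_clinear J(1) Q)
  ultimately obtain P where P: "orth_projection P" "\<And>x. P x \<in> V" "\<And>x. x \<in> V \<Longrightarrow> P x = x"
    using orth_projection_exists by blast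
  have P_lin: "bounded_clinear P" and P_adj: "is_adjoint P P" and PP: "\<And>x. P (P x) = P x"
    using P(1) by (auto simp: orth_projection_def)
  show ?thesis
  proof (rule that[OF P(1)])
    show "0 \<le> Re (cinner (Q (P x)) (P x))" for x
      using J_pos[of "P x"] P(2)[of x] by (simp add: V_def)
    show "Re (cinner (Q (x - P x)) (x - P x)) \<le> 0" for x
    proof -
      define u where "u = x - P x"
      have "P u = 0" by (simp add: u_def bounded_clinear_simps[OF P_lin] PP)
      have orth: "cinner u v = 0" if "v \<in> V" for v
        using is_adjointD[OF P_adj, of u v] P(3)[OF that] \<open>P u = 0\<close> by simp
      have QJ: "Q (J z) = J (Q z)" for z by (rule J_comm[OF Q]) simp
      have in_V: "J z + Q z \<in> V" for z
        by (simp add: V_def bounded_clinear_simps[OF J(1)] bounded_clinear_simps[OF Q] J_sq QJ add.commute)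
      define w where "w = J u + Q u"
      have "cinner w w = cinner u (J w + Q w)"
        unfolding cinner_add_right is_adjointD[OF J(2), symmetric] is_adjointD[OF adj, symmetric]
        by (simp add: w_def cinner_add_left)
      hence "w = 0" using orth[OF in_V] by (simp add: cinner_eq_zero_iff)
      hence "Q u = - J u" by (simp add: w_def add_eq_0_iff)
      thus ?thesis using J_pos[of u] by (simp add: u_def)
    qed
    show "P (X x) = X (P x)" if X: "bounded_clinear X" "is_adjoint X X'" and comm: "\<And>x. X (Q x) = Q (X x)" for X X' x
    proof (rule orth_projection_commute[OF P(1) X(2)])
      have X': "bounded_clinear X'" by (rule bounded_clinear_is_adjoint[OF X(2,1)])
      have comm': "X' (Q x) = Q (X' x)" for x by (rule commute_adjoint[OF X(2) adj comm])
      show "P (X (P z)) = X (P z)" for z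
        using P(2)[of z] J_comm[OF X(1) comm, of "P z"] comm[of "P z"] by (intro P(3)) (simp add: V_def)
      show "P (X' (P z)) = X' (P z)" for z
        using P(2)[of z] J_comm[OF X' comm', of "P z"] comm'[of "P z"] by (intro P(3)) (simp add: V_def)
    qed
  qed
qed

section \<open>Disc cuts of a normal operator\<close>

definition normal_operator :: "('a::complex_inner \<Rightarrow> 'a) \<Rightarrow> ('a \<Rightarrow> 'a) \<Rightarrow> bool" where
  "normal_operator S S' \<longleftrightarrow> bounded_clinear S \<and> is_adjoint S S' \<and> (\<forall>x. S (S' x) = S' (S x))"

text \<open>\<open>P\<close> is a spectral projection for the complement of the disc of radius \<open>t\<^sup>1\<^sup>/\<^sup>2\<close> around \<open>c\<close>;
  on which side the boundary circle lies is left open.\<close>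

definition disc_cut ::
  "('a::complex_inner \<Rightarrow> 'a) \<Rightarrow> ('a \<Rightarrow> 'a) \<Rightarrow> complex \<Rightarrow> real \<Rightarrow> ('a \<Rightarrow> 'a) \<Rightarrow> bool" where
  "disc_cut S S' c t P \<longleftrightarrow> orth_projection P \<and>
    (\<forall>X X'. bounded_clinear X \<and> is_adjoint X X' \<and> (\<forall>x. X (S x) = S (X x)) \<and> (\<forall>x. X (S' x) = S' (X x)) \<longrightarrow>
      (\<forall>x. P (X x) = X (P x))) \<and>
    (\<forall>x. t * (norm (P x))\<^sup>2 \<le> (norm (shift S c (P x)))\<^sup>2) \<and>
    (\<forall>x. (norm (shift S c (x - P x)))\<^sup>2 \<le> t * (norm (x - P x))\<^sup>2)"

lemma normal_operator_shift_norm: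
  assumes "normal_operator S S'"
  shows "norm (shift S' (cnj c) x) = norm (shift S c x)"
proof -
  have S: "bounded_clinear S" and adj: "is_adjoint S S'" and nrm: "\<And>x. S (S' x) = S' (S x)"
    using assms by (auto simp: normal_operator_def)
  note S' = bounded_clinear_is_adjoint[OF adj S]
  note adjs = is_adjoint_shift[OF adj, of c]
  have "cinner (shift S' (cnj c) x) (shift S' (cnj c) x) = cinner x (shift S c (shift S' (cnj c) x))"
    by (rule is_adjointD[OF is_adjoint_sym[OF adjs]])
  also have "shift S c (shift S' (cnj c) x) = shift S' (cnj c) (shift S c x)"
    by (simp add: shift_def bounded_clinear_simps[OF S] bounded_clinear_simps[OF S'] nrm
        scaleC_distribs scaleC_scaleC mult.commute)
  also have "cinner x \<dots> = cinner (shift S c x) (shift S c x)"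
    by (rule is_adjointD[OF adjs, symmetric])
  finally have "(norm (shift S' (cnj c) x))\<^sup>2 = (norm (shift S c x))\<^sup>2"
    by (simp only: cinner_self of_real_eq_iff)
  thus ?thesis by simp
qed

text \<open>The spectral splitting is applied to the adjoint of \<open>shift S c\<close> times
  \<open>shift S c\<close>, minus \<open>t\<close>; the sign of its quadratic form is the comparison
  with the disc.\<close>

lemma disc_cut_exists:
  fixes S :: "'a::chilbert_space \<Rightarrow> 'a"
  assumes "normal_operator S S'"
  obtains P where "disc_cut S S' c t P"
proof -
  have S: "bounded_clinear S" and adj: "is_adjoint S S'"
    using assms by (auto simp: normal_operator_def)
  note S' = bounded_clinear_is_adjoint[OF adj S]
  note adjs = is_adjoint_shift[OF adj, of c]
  define Q where "Q x = shift S' (cnj c) (shift S c x) - t *\<^sub>R x" for x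
  have Q: "bounded_clinear Q"
    unfolding Q_def by (intro bounded_clinear_minus_fun bounded_clinear_scaleR_fun bounded_clinear_id
        bounded_clinear_compose[OF bounded_clinear_shift[OF S'] bounded_clinear_shift[OF S]])
  have Q_adj: "is_adjoint Q Q"
    by (simp add: is_adjoint_def Q_def cinner_diff_left cinner_diff_right is_adjointD[OF adjs]
        is_adjointD[OF is_adjoint_sym[OF adjs]])
  have Q_form: "Re (cinner (Q x) x) = (norm (shift S c x))\<^sup>2 - t * (norm x)\<^sup>2" for x
    by (simp add: Q_def cinner_diff_left is_adjointD[OF is_adjoint_sym[OF adjs]] cinner_self)
  obtain P where P: "orth_projection P"
    "\<And>x. 0 \<le> Re (cinner (Q (P x)) (P x))" "\<And>x. Re (cinner (Q (x - P x)) (x - P x)) \<le> 0"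
    "\<And>X X' x. bounded_clinear X \<Longrightarrow> is_adjoint X X' \<Longrightarrow> (\<And>x. X (Q x) = Q (X x)) \<Longrightarrow> P (X x) = X (P x)"
    using selfadjoint_spectral_cut[OF Q Q_adj] by blast
  have "P (X x) = X (P x)" if X: "bounded_clinear X" "is_adjoint X X'"
    and comm: "\<And>x. X (S x) = S (X x)" "\<And>x. X (S' x) = S' (X x)" for X X' x
  proof (rule P(4)[OF X])
    show "X (Q x) = Q (X x)" for x
      by (simp add: Q_def shift_def bounded_clinear_simps[OF X(1)] comm)
  qed
  thus ?thesis
    using P(1-3) by (intro that[of P]) (auto simp: disc_cut_def Q_form)
qed

lemma disc_cutD:
  assumes "disc_cut S S' c t P"
  shows disc_cut_projection: "orth_projection P"
    and disc_cut_lower: "t * (norm (P x))\<^sup>2 \<le> (norm (shift S c (P x)))\<^sup>2"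
    and disc_cut_upper: "(norm (shift S c (x - P x)))\<^sup>2 \<le> t * (norm (x - P x))\<^sup>2"
    and disc_cut_commute: "bounded_clinear X \<Longrightarrow> is_adjoint X X' \<Longrightarrow> (\<And>x. X (S x) = S (X x)) \<Longrightarrow>
      (\<And>x. X (S' x) = S' (X x)) \<Longrightarrow> P (X x) = X (P x)"
  using assms unfolding disc_cut_def by blast+

section \<open>Majorization of vectors by the shifts of a normal operator\<close>

lemma shift_eq_shift: "shift S m x = shift S c x - (m - c) *\<^sub>C x"
  by (simp add: shift_def scaleC_distribs)

lemma norm_shift_le_shift:
  fixes x :: "'a::complex_inner"
  shows "norm (shift S m x) \<le> norm (shift S c x) + dist m c * norm x"
  unfolding shift_eq_shift[of S m x c]
  using norm_triangle_ineq4[of "shift S c x" "(m - c) *\<^sub>C x"] by (simp add: norm_scaleC dist_norm)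

lemma disc_cut_commute_shift:
  assumes "normal_operator S S'" and cut: "disc_cut S S' c t P"
  shows "P (shift S m x) = shift S m (P x)"
proof -
  have S: "bounded_clinear S" "is_adjoint S S'" "\<And>x. S (S' x) = S' (S x)"
    using assms(1) by (auto simp: normal_operator_def)
  have P: "bounded_clinear P" using disc_cut_projection[OF cut] by (simp add: orth_projection_def)
  have "P (S x) = S (P x)" by (rule disc_cut_commute[OF cut S(1,2)]) (simp_all add: S(3))
  thus ?thesis by (simp add: shift_def bounded_clinear_simps[OF P])
qed

lemma normal_locally_majorized_imp_zero:
  fixes S :: "'a::chilbert_space \<Rightarrow> 'a"
  assumes "normal_operator S S'"
    and "\<And>l. \<exists>e>0. \<exists>C. \<forall>m\<in>ball l e. \<forall>x. cmod (cinner y x) \<le> C * norm (shift S m x)"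
  shows "y = 0"
proof (rule dominant_majorized_imp_zero)
  show "bounded_clinear S" "is_adjoint S S'" using assms(1) by (auto simp: normal_operator_def)
  show "\<exists>C. \<forall>x. norm (shift S' (cnj l) x) \<le> C * norm (shift S l x)" for l
    by (rule exI[of _ 1]) (simp add: normal_operator_shift_norm[OF assms(1)])
qed (simp add: normal_operator_shift_norm[OF assms(1)] assms(2))

text \<open>On the range of \<open>1 - P\<close>, which is invariant under \<open>S\<close>, the
  norm of \<open>S - c\<close> is at most \<open>sqrt t\<close>, so \<open>S - m\<close> is bounded
  below there by \<open>dist m c - sqrt t\<close>.\<close>

lemma disc_cut_majorized_outside:
  assumes nrm: "normal_operator S S'" and cut: "disc_cut S S' c t P"
    and "t \<ge> 0" and m: "sqrt t < dist m c"
  shows "cmod (cinner (w - P w) x) \<le> norm w / (dist m c - sqrt t) * norm (shift S m x)"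
proof -
  define R where "R x = x - P x" for x
  have R: "orth_projection R"
    unfolding R_def by (rule orth_projection_complement[OF disc_cut_projection[OF cut]])
  have "shift S m (R x) = R (shift S m x)"
    using nrm bounded_clinear_shift[of S m]
    by (simp add: R_def disc_cut_commute_shift[OF nrm cut] normal_operator_def bounded_clinear_diff)
  moreover have "norm (shift S c (R x)) \<le> sqrt t * norm (R x)"
    using disc_cut_upper[OF cut, of x] \<open>t \<ge> 0\<close> unfolding R_def[symmetric]
    by (metis mult_nonneg_nonneg norm_ge_zero power2_le_imp_le power_mult_distrib real_sqrt_ge_zero real_sqrt_pow2)
  moreover have "dist m c * norm (R x) \<le> norm (shift S c (R x)) + norm (shift S m (R x))"
  proof -
    have "(m - c) *\<^sub>C R x = shift S c (R x) - shift S m (R x)"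
      unfolding shift_eq_shift[of S m _ c] by simp
    thus ?thesis
      using norm_triangle_ineq4[of "shift S c (R x)" "shift S m (R x)"]
      by (metis norm_scaleC dist_norm)
  qed
  ultimately have "(dist m c - sqrt t) * norm (R x) \<le> norm (R (shift S m x))"
    by (simp add: algebra_simps)
  also have "\<dots> \<le> norm (shift S m x)" by (rule norm_orth_projection_le[OF R])
  finally have *: "norm (R x) \<le> norm (shift S m x) / (dist m c - sqrt t)"
    using m by (simp add: pos_le_divide_eq mult.commute)
  have "cinner (R w) x = cinner w (R x)"
    using R is_adjointD[of R R w x] by (simp add: orth_projection_def)
  hence "cmod (cinner (R w) x) \<le> norm w * norm (R x)"
    using cinner_Cauchy_Schwarz[of w "R x"] by simp
  also have "\<dots> \<le> norm w * (norm (shift S m x) / (dist m c - sqrt t))"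
    using * by (intro mult_left_mono) auto
  finally show ?thesis by (simp add: R_def)
qed

lemma disc_cut_majorized:
  assumes nrm: "normal_operator S S'" and cut: "disc_cut S S' c t P"
    and maj: "\<And>x. cmod (cinner w x) \<le> C * norm (shift S m x)"
  shows "cmod (cinner (w - P w) x) \<le> max C 0 * norm (shift S m x)"
proof -
  define R where "R x = x - P x" for x
  have R: "orth_projection R"
    unfolding R_def by (rule orth_projection_complement[OF disc_cut_projection[OF cut]])
  have comm: "shift S m (R x) = R (shift S m x)"
    using nrm bounded_clinear_shift[of S m]
    by (simp add: R_def disc_cut_commute_shift[OF nrm cut] normal_operator_def bounded_clinear_diff)
  have "cinner (R w) x = cinner w (R x)"
    using R is_adjointD[of R R w x] by (simp add: orth_projection_def)
  hence "cmod (cinner (R w) x) \<le> C * norm (R (shift S m x))"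
    using maj[of "R x"] by (simp add: comm)
  also have "\<dots> \<le> max C 0 * norm (R (shift S m x))" by (intro mult_right_mono) auto
  also have "\<dots> \<le> max C 0 * norm (shift S m x)"
    by (intro mult_left_mono norm_orth_projection_le[OF R]) auto
  finally show ?thesis by (simp add: R_def)
qed

text \<open>\<open>w - P w\<close> inherits local majorization from \<open>w\<close> in the larger
  disc and has it off the smaller disc by the cut; since \<open>sqrt t < r\<close>, Liouville's
  argument covers the whole plane.\<close>

lemma disc_cut_locally_majorized:
  fixes S :: "'a::chilbert_space \<Rightarrow> 'a"
  assumes nrm: "normal_operator S S'" and cut: "disc_cut S S' c t P"
    and t: "t \<ge> 0" "sqrt t < r"
    and maj: "\<And>l. l \<in> ball c r \<Longrightarrow>
      \<exists>e>0. \<exists>C. \<forall>m\<in>ball l e. \<forall>x. cmod (cinner w x) \<le> C * norm (shift S m x)"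
  shows "P w = w"
proof -
  have "w - P w = 0"
  proof (rule normal_locally_majorized_imp_zero[OF nrm])
    fix l
    show "\<exists>e>0. \<exists>C. \<forall>m\<in>ball l e. \<forall>x. cmod (cinner (w - P w) x) \<le> C * norm (shift S m x)"
    proof (cases "l \<in> ball c r")
      case True
      then obtain e C where "e > 0" "\<And>m x. m \<in> ball l e \<Longrightarrow> cmod (cinner w x) \<le> C * norm (shift S m x)"
        using maj by blast
      thus ?thesis
        using disc_cut_majorized[OF nrm cut] by (intro exI[of _ e] conjI exI[of _ "max C 0"]) auto
    next
      case False
      \<comment> \<open>Half the gap between the radii: every \<open>m\<close> within
        \<open>d\<close> of \<open>l\<close> keeps distance at least \<open>d\<close> from the
        smaller disc.\<close>
      define d where "d = (r - sqrt t) / 2"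
      have d: "d > 0" using t by (simp add: d_def)
      have "cmod (cinner (w - P w) x) \<le> norm w / d * norm (shift S m x)" if "m \<in> ball l d" for m x
      proof -
        have "r \<le> dist c l" using False by simp
        also have "\<dots> \<le> dist m c + dist l m" by (metis dist_commute dist_triangle add.commute)
        finally have *: "d \<le> dist m c - sqrt t" using that by (simp add: d_def field_simps)
        have "cmod (cinner (w - P w) x) \<le> norm w / (dist m c - sqrt t) * norm (shift S m x)"
          using * d by (intro disc_cut_majorized_outside[OF nrm cut t(1)]) simp
        also have "\<dots> \<le> norm w / d * norm (shift S m x)"
          using * d by (intro mult_right_mono divide_left_mono) auto
        finally show ?thesis .
      qed
      thus ?thesis using d by blast
    qed
  qed
  thus ?thesis by simp
qed

text \<open>Baire's theorem is applied inside \<open>E\<close>, which may have empty interior: were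
  every \<open>E - F n\<close> dense in \<open>E\<close>, so would be their empty
  intersection.\<close>

lemma closed_cover_Baire:
  fixes E :: "'a::{real_normed_vector, heine_borel} set" and F :: "nat \<Rightarrow> 'a set"
  assumes E: "closed E" "E \<noteq> {}" and F: "\<And>n. closed (F n)" and cover: "E \<subseteq> (\<Union>n. F n)"
  obtains e r n where "e \<in> E" "r > 0" "E \<inter> ball e r \<subseteq> F n"
proof -
  have "\<exists>n. \<not> E \<subseteq> closure (E - F n)"
  proof (rule ccontr)
    assume "\<nexists>n. \<not> E \<subseteq> closure (E - F n)"
    moreover have "openin (top_of_set E) (E - F n)" for n
      using F[of n] by (auto simp: openin_open Diff_eq intro!: exI[of _ "- F n"])
    ultimately have "E \<subseteq> closure (\<Inter>(range (\<lambda>n. E - F n)))"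
      using E(1) by (intro Baire) auto
    moreover have "\<Inter>(range (\<lambda>n. E - F n)) = {}" using cover by auto
    ultimately have "E \<subseteq> closure {}" by (simp only:)
    thus False using E(2) by simp
  qed
  then obtain n e where e: "e \<in> E" "e \<notin> closure (E - F n)" by blast
  then obtain r where "r > 0" and r: "\<And>y. y \<in> E - F n \<Longrightarrow> \<not> dist y e < r"
    by (auto simp: closure_approachable)
  have "E \<inter> ball e r \<subseteq> F n"
  proof
    show "y \<in> F n" if "y \<in> E \<inter> ball e r" for y
      using r[of y] that by (cases "y \<in> F n") (simp_all add: dist_commute)
  qed
  thus ?thesis using e(1) \<open>r > 0\<close> that by blast
qed

lemma continuous_on_shift: "continuous_on U (\<lambda>m. shift S m x)"
  for x :: "'a::complex_inner"
proof -
  have "bounded_clinear (\<lambda>m::complex. m *\<^sub>C x)"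
    by (rule bounded_clinearI[where K = "norm x"])
      (auto simp: scaleC_add_left scaleC_scaleC scaleC_complex_def norm_scaleC mult.commute)
  thus ?thesis
    unfolding shift_def by (intro continuous_on_diff continuous_on_const continuous_on_bounded_clinear)
qed

text \<open>Putnam's theorem that \<open>\<Inter>\<^sub>m ran (S - m) = 0\<close> for normal \<open>S\<close>. Near an exceptional point \<open>e\<close>
  selected by Baire's theorem, the majorizing constant at a regular point \<open>l\<close> is controlled by the
  one at the exceptional point nearest to \<open>l\<close>: there is no spectral mass of \<open>w\<close> in between.\<close>

lemma normal_majorized_imp_zero:
  fixes S :: "'a::chilbert_space \<Rightarrow> 'a"
  assumes nrm: "normal_operator S S'"
    and maj: "\<And>m. \<exists>C. \<forall>x. cmod (cinner w x) \<le> C * norm (shift S m x)"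
  shows "w = 0"
proof -
  define F where "F n = {m. \<forall>x. cmod (cinner w x) \<le> real n * norm (shift S m x)}" for n
  \<comment> \<open>The points near which no single constant majorizes \<open>w\<close>. Once
    \<open>E\<close> is empty, the local criterion applies everywhere.\<close>
  define E where "E = {l. \<forall>e>0. \<forall>n. \<not> ball l e \<subseteq> F n}"
  have F_closed: "closed (F n)" for n
    unfolding F_def by (intro closed_Collect_all closed_Collect_le continuous_intros continuous_on_shift)
  have F_cover: "\<exists>n. m \<in> F n" for m
  proof -
    obtain C where C: "\<And>x. cmod (cinner w x) \<le> C * norm (shift S m x)" using maj by blast
    obtain n where "C \<le> real n" using real_arch_simple by blast
    have "cmod (cinner w x) \<le> real n * norm (shift S m x)" for x
      by (rule order_trans[OF C mult_right_mono[OF \<open>C \<le> real n\<close> norm_ge_zero]])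
    thus ?thesis by (auto simp: F_def)
  qed
  have "open (- E)"
    unfolding open_contains_ball
  proof
    fix l assume "l \<in> - E"
    then obtain e n where e: "e > 0" "ball l e \<subseteq> F n" by (auto simp: E_def)
    have "ball l e \<subseteq> - E"
    proof
      fix y assume "y \<in> ball l e"
      then obtain e' where "e' > 0" "ball y e' \<subseteq> ball l e"
        using open_ball open_contains_ball by blast
      thus "y \<in> - E" using e(2) by (auto simp: E_def)
    qed
    thus "\<exists>e>0. ball l e \<subseteq> - E" using e(1) by blast
  qed
  hence E_closed: "closed E" by (simp add: closed_def)
  have off_E: "\<exists>e>0. \<exists>C. \<forall>m\<in>ball l e. \<forall>x. cmod (cinner w x) \<le> C * norm (shift S m x)" if l: "l \<notin> E" for l
  proof -
    obtain e n where "e > 0" "ball l e \<subseteq> F n" using l unfolding E_def by blast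
    thus ?thesis unfolding F_def by blast
  qed
  have "E = {}"
  proof (rule ccontr)
    assume "E \<noteq> {}"
    have "E \<subseteq> (\<Union>n. F n)" using F_cover by auto
    from closed_cover_Baire[OF E_closed \<open>E \<noteq> {}\<close> F_closed this]
    obtain e r n where e: "e \<in> E" and r: "r > 0" and E_F: "E \<inter> ball e r \<subseteq> F n" .
    \<comment> \<open>Half the radius keeps the point \<open>l0\<close> of \<open>E\<close> nearest
      to \<open>l\<close> within \<open>ball e r\<close>. The factor 3 arises because
      \<open>d * norm (P x)\<close> is at most twice \<open>norm (shift S l (P x))\<close>, so
      moving the centre from \<open>l\<close> to \<open>l0\<close> adds at most that.\<close>
    have "ball e (r/2) \<subseteq> F (3 * n)"
    proof
      fix l assume l: "l \<in> ball e (r/2)"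
      show "l \<in> F (3 * n)"
      proof (cases "l \<in> E")
        case True
        hence "l \<in> F n" using l r E_F by auto
        moreover have "real n * norm (shift S l x) \<le> real (3 * n) * norm (shift S l x)" for x
          by (intro mult_right_mono) auto
        ultimately show ?thesis unfolding F_def by (blast intro: order_trans)
      next
        case False
        obtain l0 where l0: "l0 \<in> E" and nearest: "\<And>y. y \<in> E \<Longrightarrow> dist l l0 \<le> dist l y"
          using distance_attains_inf[OF E_closed \<open>E \<noteq> {}\<close>] by blast
        define d where "d = dist l l0"
        have d: "d > 0" using False l0 by (auto simp: d_def)
        have "dist e l0 \<le> dist e l + dist l l0" by (rule dist_triangle)
        also have "\<dots> < r" using l nearest[OF e] by (simp add: dist_commute)
        finally have l0_F: "l0 \<in> F n" using E_F l0 by auto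
        \<comment> \<open>\<open>ball l d\<close> misses \<open>E\<close>, so \<open>w\<close> is
          locally majorized there and the smaller disc carries none of it.\<close>
        obtain P where cut: "disc_cut S S' l ((d/2)\<^sup>2) P"
          using disc_cut_exists[OF nrm] by blast
        have "P w = w"
        proof (rule disc_cut_locally_majorized[OF nrm cut])
          show "sqrt ((d/2)\<^sup>2) < d" using d by simp
          show "\<exists>e>0. \<exists>C. \<forall>m\<in>ball z e. \<forall>x. cmod (cinner w x) \<le> C * norm (shift S m x)"
            if "z \<in> ball l d" for z
            using that nearest by (intro off_E) (fastforce simp: d_def)
        qed simp
        have P: "orth_projection P" by (rule disc_cut_projection[OF cut])
        have "cmod (cinner w x) \<le> real (3 * n) * norm (shift S l x)" for x
        proof -
          have "(d/2 * norm (P x))\<^sup>2 \<le> (norm (shift S l (P x)))\<^sup>2"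
            unfolding power_mult_distrib by (rule disc_cut_lower[OF cut])
          hence *: "d * norm (P x) \<le> 2 * norm (shift S l (P x))"
            using power2_le_imp_le[of "d/2 * norm (P x)" "norm (shift S l (P x))"] by simp
          have "cinner w x = cinner w (P x)"
            using P is_adjointD[of P P w x] \<open>P w = w\<close> by (simp add: orth_projection_def)
          hence "cmod (cinner w x) \<le> real n * norm (shift S l0 (P x))"
            using l0_F by (simp add: F_def)
          also have "\<dots> \<le> real n * (3 * norm (shift S l (P x)))"
            using norm_shift_le_shift[of S l0 "P x" l] *
            by (intro mult_left_mono) (auto simp: d_def dist_commute)
          also have "\<dots> = real (3 * n) * norm (P (shift S l x))"
            by (simp add: disc_cut_commute_shift[OF nrm cut])
          also have "\<dots> \<le> real (3 * n) * norm (shift S l x)"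
            by (intro mult_left_mono norm_orth_projection_le[OF P]) auto
          finally show ?thesis .
        qed
        thus ?thesis by (simp add: F_def)
      qed
    qed
    thus False using e r unfolding E_def by (metis (mono_tags, lifting) half_gt_zero mem_Collect_eq)
  qed
  thus "w = 0" using off_E by (intro normal_locally_majorized_imp_zero[OF nrm]) auto
qed

section \<open>Intertwining operators\<close>

lemma intertwiner_adjoint_shift:
  assumes "bounded_clinear Y" "is_adjoint Y Y'" "is_adjoint S S'" "is_adjoint B B'"
    and twine: "\<And>x. Y (S x) = B (Y x)"
  shows "shift S' (cnj m) (Y' k) = Y' (shift B' (cnj m) k)"
proof (rule cinner_ext)
  fix z
  have "Y (shift S m z) = shift B m (Y z)"
    using assms(1) by (simp add: shift_def bounded_clinear_simps twine)
  thus "cinner z (shift S' (cnj m) (Y' k)) = cinner z (Y' (shift B' (cnj m) k))"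
    by (simp add: is_adjointD[OF is_adjoint_shift[OF assms(3)], symmetric]
        is_adjointD[OF is_adjoint_shift[OF assms(4)], symmetric] is_adjointD[OF assms(2), symmetric])
qed

text \<open>For every \<open>m\<close> one has
  \<open>S A - A S = (A - cnj m)\<^sup>* (A - cnj m) - (S - m)\<^sup>* (S - m)\<close>, where \<open>S = A\<^sup>*\<close>. By hyponormality its
  range therefore lies in the range of every \<open>S - m\<close>, and an intertwiner must vanish on it.\<close>

lemma intertwiner_self_commutator:
  fixes A S :: "'g::chilbert_space \<Rightarrow> 'g" and B :: "'k::chilbert_space \<Rightarrow> 'k"
  assumes A: "bounded_clinear A" "is_adjoint A S"
    and hyp: "\<And>l x. norm (shift S (cnj l) x) \<le> c * norm (shift A l x)" and "c \<ge> 0"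
    and B: "bounded_clinear B" "is_adjoint B B'"
    and dom: "\<And>l. \<exists>C. \<forall>x. norm (shift B' (cnj l) x) \<le> C * norm (shift B l x)"
    and Y: "bounded_clinear Y" and twine: "\<And>x. Y (S x) = B (Y x)"
  shows "Y (S (A x)) = Y (A (S x))"
proof -
  have S: "bounded_clinear S" "is_adjoint S A"
    using A bounded_clinear_is_adjoint is_adjoint_sym by blast+
  define D where "D = S (A x) - A (S x)"
  obtain Y' where Y_adj: "is_adjoint Y Y'" using is_adjoint_adjoint[OF Y] by blast
  have Y': "bounded_clinear Y'" by (rule bounded_clinear_is_adjoint[OF Y_adj Y])
  obtain K where K: "K > 0" "\<And>k. norm (Y' k) \<le> K * norm k" using bounded_clinear_bound[OF Y'] by blast
  have D_eq: "cinner D z = cinner (shift A (cnj m) x) (shift A (cnj m) z) - cinner (shift S m x) (shift S m z)" for z m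
    by (simp add: D_def shift_def cinner_distribs is_adjointD[OF A(2)] is_adjointD[OF S(2)] algebra_simps)
  have bound: "cmod (cinner (Y D) k) \<le> ((1 + c * c) * norm (shift A (cnj m) x) * K) * norm (shift B' (cnj m) k)" for m k
  proof -
    let ?z = "Y' k" and ?a = "\<lambda>z. norm (shift A (cnj m) z)"
    have hyp': "norm (shift S m z) \<le> c * ?a z" for z using hyp[of "cnj m" z] by simp
    have "cmod (cinner (Y D) k) = cmod (cinner D ?z)" by (simp add: is_adjointD[OF Y_adj])
    also have "\<dots> \<le> ?a x * ?a ?z + norm (shift S m x) * norm (shift S m ?z)"
      unfolding D_eq[of _ m]
      by (rule order_trans[OF norm_triangle_ineq4 add_mono[OF cinner_Cauchy_Schwarz cinner_Cauchy_Schwarz]])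
    also have "\<dots> \<le> ?a x * ?a ?z + (c * ?a x) * (c * ?a ?z)"
      using \<open>c \<ge> 0\<close> hyp' by (intro add_left_mono mult_mono) auto
    also have "\<dots> = ((1 + c * c) * ?a x) * ?a ?z" by (simp add: algebra_simps)
    also have "?a ?z = norm (Y' (shift B' (cnj m) k))"
      using intertwiner_adjoint_shift[OF Y Y_adj S(2) B(2) twine] by simp
    also have "((1 + c * c) * ?a x) * \<dots> \<le> ((1 + c * c) * ?a x) * (K * norm (shift B' (cnj m) k))"
      by (intro mult_left_mono K(2)) auto
    finally show ?thesis by (simp add: mult.assoc)
  qed
  have "Y D = 0"
  proof (rule dominant_majorized_imp_zero[OF B dom])
    fix l
    \<comment> \<open>Over the unit ball around \<open>l\<close> the vector
      \<open>shift A (cnj m) x\<close> moves by at most \<open>norm x\<close>, so \<open>C\<close>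
      is uniform in \<open>m\<close>.\<close>
    define C where "C = (1 + c * c) * (norm (shift A (cnj l) x) + norm x) * K"
    have "cmod (cinner (Y D) k) \<le> C * norm (shift B' (cnj m) k)" if "m \<in> ball l 1" for m k
    proof -
      have "dist (cnj m) (cnj l) \<le> 1"
        using that by (simp add: dist_norm norm_minus_commute flip: complex_cnj_diff)
      from mult_right_mono[OF this norm_ge_zero[of x]]
      have "norm (shift A (cnj m) x) \<le> norm (shift A (cnj l) x) + norm x"
        using norm_shift_le_shift[of A "cnj m" x "cnj l"] by simp
      hence "(1 + c * c) * norm (shift A (cnj m) x) * K \<le> C"
        unfolding C_def using K(1) by (intro mult_right_mono mult_left_mono) auto
      hence "((1 + c * c) * norm (shift A (cnj m) x) * K) * norm (shift B' (cnj m) k) \<le> C * norm (shift B' (cnj m) k)"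
        by (intro mult_right_mono) auto
      thus ?thesis using bound[of k m] by linarith
    qed
    thus "\<exists>e>0. \<exists>C. \<forall>m\<in>ball l e. \<forall>k. cmod (cinner (Y D) k) \<le> C * norm (shift B' (cnj m) k)"
      by (intro exI[of _ 1] conjI exI[of _ C]) auto
  qed
  thus ?thesis by (simp add: D_def bounded_clinear_simps[OF Y])
qed

text \<open>Let \<open>V\<close> be the common kernel of all intertwiners. With \<open>Y\<close>
  also \<open>Y A\<close> is an intertwiner, by the self-commutator lemma, so \<open>V\<close>
  reduces \<open>S\<close>. The self-commutator maps into \<open>V\<close>, so \<open>S\<close> is
  normal on the orthogonal complement; \<open>N\<close> extends this part by zero.\<close>

lemma intertwiners_factor_through_normal:
  fixes A S :: "'g::chilbert_space \<Rightarrow> 'g" and B :: "'k::chilbert_space \<Rightarrow> 'k"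
  assumes A: "bounded_clinear A" "is_adjoint A S"
    and hyp: "\<And>l x. norm (shift S (cnj l) x) \<le> c * norm (shift A l x)" and "c \<ge> 0"
    and B: "bounded_clinear B" "is_adjoint B B'"
    and dom: "\<And>l. \<exists>C. \<forall>x. norm (shift B' (cnj l) x) \<le> C * norm (shift B l x)"
  obtains N N' where "normal_operator N N'"
    "\<And>Y x. bounded_clinear Y \<Longrightarrow> (\<And>x. Y (S x) = B (Y x)) \<Longrightarrow> Y (N x) = B (Y x)"
proof -
  have S: "bounded_clinear S" "is_adjoint S A"
    using A bounded_clinear_is_adjoint is_adjoint_sym by blast+
  define I where "I = {Y. bounded_clinear Y \<and> (\<forall>x. Y (S x) = B (Y x))}"
  define V where "V = {x. \<forall>Y\<in>I. Y x = 0}"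
  have lin: "bounded_clinear Y" and twine: "Y (S x) = B (Y x)" if "Y \<in> I" for Y x
    using that by (auto simp: I_def)
  have comm: "Y (S (A x)) = Y (A (S x))" if "Y \<in> I" for Y x
    using intertwiner_self_commutator[OF A hyp \<open>c \<ge> 0\<close> B dom lin[OF that] twine[OF that]] .
  have I_A: "(\<lambda>x. Y (A x)) \<in> I" if "Y \<in> I" for Y
    using that comm[OF that] by (auto simp: I_def intro!: bounded_clinear_compose[OF _ A(1)])
  have "csubspace V"
    using lin by (auto simp: csubspace_def V_def bounded_clinear_simps)
  moreover have "closed V"
  proof -
    have "V = (\<Inter>Y\<in>I. {x. Y x = 0})" by (auto simp: V_def)
    moreover have "closed {x. Y x = 0}" if "Y \<in> I" for Y
      by (intro closed_Collect_eq continuous_on_bounded_clinear continuous_on_const lin that)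
    ultimately show ?thesis by auto
  qed
  ultimately obtain P where P: "orth_projection P" "\<And>x. P x \<in> V" "\<And>x. x \<in> V \<Longrightarrow> P x = x"
    using orth_projection_exists by blast
  have S_V: "S x \<in> V" if "x \<in> V" for x
    unfolding V_def
  proof (intro CollectI ballI)
    fix Y assume Y: "Y \<in> I"
    hence "Y x = 0" using that unfolding V_def by blast
    thus "Y (S x) = 0" by (simp only: twine[OF Y] bounded_clinear_zero[OF B(1)])
  qed
  have A_V: "A x \<in> V" if "x \<in> V" for x
    using that I_A by (auto simp: V_def)
  have P_S: "P (S x) = S (P x)" and P_A: "P (A x) = A (P x)" for x
    using S_V A_V P by (intro orth_projection_commute[OF P(1) S(2)] orth_projection_commute[OF P(1) A(2)]; blast)+
  define R where "R x = x - P x" for x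
  have R: "orth_projection R"
    unfolding R_def by (rule orth_projection_complement[OF P(1)])
  hence R_lin: "bounded_clinear R" and R_adj: "is_adjoint R R" and RR: "\<And>x. R (R x) = R x"
    by (auto simp: orth_projection_def)
  have R_S: "R (S x) = S (R x)" and R_A: "R (A x) = A (R x)" for x
    by (simp_all add: R_def P_S P_A bounded_clinear_diff[OF S(1)] bounded_clinear_diff[OF A(1)])
  have SA: "S (A (R x)) = A (S (R x))" for x
  proof -
    have "S (A x) - A (S x) \<in> V"
      using lin comm by (auto simp: V_def bounded_clinear_diff)
    hence "R (S (A x) - A (S x)) = 0" by (simp add: R_def P(3))
    thus ?thesis by (simp add: bounded_clinear_diff[OF R_lin] R_S R_A)
  qed
  show ?thesis
  proof (rule that)
    show "normal_operator (\<lambda>x. S (R x)) (\<lambda>x. A (R x))"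
      unfolding normal_operator_def
    proof (intro conjI allI)
      show "is_adjoint (\<lambda>x. S (R x)) (\<lambda>x. A (R x))"
        using is_adjoint_compose[OF S(2) R_adj] by (simp add: R_A)
      show "S (R (A (R x))) = A (R (S (R x)))" for x
        by (simp add: R_A R_S RR SA)
    qed (rule bounded_clinear_compose[OF S(1) R_lin])
    show "Y (S (R x)) = B (Y x)" if "bounded_clinear Y" "\<And>x. Y (S x) = B (Y x)" for Y x
    proof -
      have "Y \<in> I" using that by (simp add: I_def)
      hence "Y (P x) = 0" using P(2)[of x] by (simp add: V_def)
      thus ?thesis by (simp add: that R_def bounded_clinear_diff)
    qed
  qed
qed

text \<open>The vector \<open>w = Y\<^sup>* (Y\<^sub>0 (P f))\<close> is majorized by \<open>S - m\<close> inside the larger disc, because \<open>P f\<close> is and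
  \<open>B\<close> is dominant; what \<open>P'\<close> cuts out of \<open>w\<close> is majorized outside the smaller disc as well.\<close>

lemma intertwiners_disc_cut_orthogonal:
  fixes S :: "'g::chilbert_space \<Rightarrow> 'g" and B :: "'k::chilbert_space \<Rightarrow> 'k"
  assumes nrm: "normal_operator S S'"
    and B: "bounded_clinear B" "is_adjoint B B'"
    and dom: "\<And>l. \<exists>C. \<forall>x. norm (shift B' (cnj l) x) \<le> C * norm (shift B l x)"
    and Y0: "bounded_clinear Y0" "\<And>x. Y0 (S x) = B (Y0 x)"
    and Y: "bounded_clinear Y" "\<And>x. Y (S x) = B (Y x)"
    and cut: "disc_cut S S' c t P" and cut': "disc_cut S S' c t' P'" and t: "0 \<le> t'" "t' < t"
  shows "cinner (Y0 (P f)) (Y (y - P' y)) = 0"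
proof -
  have S: "bounded_clinear S" "is_adjoint S S'" using nrm by (auto simp: normal_operator_def)
  obtain Y0' where Y0': "is_adjoint Y0 Y0'" using is_adjoint_adjoint[OF Y0(1)] by blast
  obtain Y' where Y': "is_adjoint Y Y'" using is_adjoint_adjoint[OF Y(1)] by blast
  obtain K where K: "K > 0" "\<And>k. norm (Y0' k) \<le> K * norm k"
    using bounded_clinear_bound[OF bounded_clinear_is_adjoint[OF Y0' Y0(1)]] by blast
  obtain L where L: "L > 0" "\<And>x. norm (Y x) \<le> L * norm x"
    using bounded_clinear_bound[OF Y(1)] by blast
  have P: "orth_projection P" and P': "orth_projection P'"
    using cut cut' by (auto intro: disc_cut_projection)
  define w where "w = Y' (Y0 (P f))"
  have w_inside: "\<exists>C. \<forall>x. cmod (cinner w x) \<le> C * norm (shift S m x)" if m: "dist m c < sqrt t" for m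
  proof -
    define d where "d = sqrt t - dist m c"
    have d: "d > 0" using m by (simp add: d_def)
    have lower: "norm (P z) \<le> norm (shift S m z) / d" for z
    proof -
      have "(sqrt t * norm (P z))\<^sup>2 \<le> (norm (shift S c (P z)))\<^sup>2"
        using disc_cut_lower[OF cut, of z] t by (simp add: power_mult_distrib)
      hence "sqrt t * norm (P z) \<le> norm (shift S c (P z))"
        by (rule power2_le_imp_le) simp
      also have "\<dots> \<le> norm (shift S m (P z)) + dist m c * norm (P z)"
        using norm_shift_le_shift[of S c "P z" m] by (simp add: dist_commute)
      finally have "d * norm (P z) \<le> norm (P (shift S m z))"
        by (simp add: d_def algebra_simps disc_cut_commute_shift[OF nrm cut])
      also have "\<dots> \<le> norm (shift S m z)" by (rule norm_orth_projection_le[OF P])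
      finally show ?thesis using d by (simp add: pos_le_divide_eq mult.commute)
    qed
    obtain C where C: "\<And>k. norm (shift B' (cnj m) k) \<le> C * norm (shift B m k)" using dom by blast
    have "cmod (cinner w x) \<le> (norm f / d * K * \<bar>C\<bar> * L) * norm (shift S m x)" for x
    proof -
      let ?k = "Y x"
      have "cinner w x = cinner (P f) (Y0' ?k)"
        by (simp add: w_def is_adjointD[OF is_adjoint_sym[OF Y']] is_adjointD[OF Y0'])
      also have "\<dots> = cinner f (P (Y0' ?k))"
        using P is_adjointD[of P P f "Y0' ?k"] by (simp add: orth_projection_def)
      finally have "cmod (cinner w x) \<le> norm f * norm (P (Y0' ?k))"
        using cinner_Cauchy_Schwarz[of f "P (Y0' ?k)"] by simp
      also have "\<dots> \<le> norm f * (norm (shift S m (Y0' ?k)) / d)"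
        by (intro mult_left_mono lower) simp
      \<comment> \<open>Normality exchanges \<open>S - m\<close> for its adjoint, which is the one
        that \<open>Y0'\<close> intertwines.\<close>
      also have "norm (shift S m (Y0' ?k)) = norm (Y0' (shift B' (cnj m) ?k))"
        using intertwiner_adjoint_shift[OF Y0(1) Y0' S(2) B(2) Y0(2), of m ?k]
          normal_operator_shift_norm[OF nrm, of m "Y0' ?k"] by simp
      also have "norm f * (\<dots> / d) \<le> norm f * (K * norm (shift B' (cnj m) ?k) / d)"
        using d K by (intro mult_left_mono divide_right_mono) auto
      also have "\<dots> = (norm f / d * K) * norm (shift B' (cnj m) ?k)" by simp
      also have "\<dots> \<le> (norm f / d * K) * (\<bar>C\<bar> * norm (shift B m ?k))"
        using C[of ?k] mult_right_mono[OF abs_ge_self norm_ge_zero, of C "shift B m ?k"] K(1) d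
        by (intro mult_left_mono) auto
      also have "shift B m ?k = Y (shift S m x)"
        by (simp add: shift_def bounded_clinear_simps[OF Y(1)] Y(2))
      also have "(norm f / d * K) * (\<bar>C\<bar> * norm (Y (shift S m x))) \<le>
          (norm f / d * K) * (\<bar>C\<bar> * (L * norm (shift S m x)))"
        using K(1) d by (intro mult_left_mono L(2)) auto
      finally show ?thesis by (simp add: mult.assoc)
    qed
    thus ?thesis by blast
  qed
  have "w - P' w = 0"
  proof (rule normal_majorized_imp_zero[OF nrm])
    fix m
    show "\<exists>C. \<forall>x. cmod (cinner (w - P' w) x) \<le> C * norm (shift S m x)"
    proof (cases "dist m c < sqrt t")
      case True
      thus ?thesis using w_inside disc_cut_majorized[OF nrm cut'] by blast
    next
      case False
      hence "sqrt t' < dist m c" using t by (meson not_less order_less_le_trans real_sqrt_less_iff)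
      thus ?thesis using disc_cut_majorized_outside[OF nrm cut' t(1)] by blast
    qed
  qed
  moreover have "cinner (Y0 (P f)) (Y (y - P' y)) = cinner w (y - P' y)"
    by (simp add: w_def is_adjointD[OF is_adjoint_sym[OF Y']])
  moreover have "cinner w (y - P' y) = cinner (w - P' w) y"
    using P' is_adjointD[of P' P' w y] by (simp add: orth_projection_def cinner_distribs)
  ultimately show ?thesis by simp
qed

section \<open>Intertwiners without a nontrivial cut\<close>

text \<open>Polarization: the form at \<open>u + Q u\<close> minus the form at
  \<open>u - Q u\<close> is four times the squared norm of \<open>Q u\<close>. The condition
  \<open>e \<le> 1\<close> lets the term in \<open>Q u\<close> on the right be absorbed.\<close>

lemma selfadjoint_norm_le_of_form:
  assumes Q: "bounded_clinear Q" "is_adjoint Q Q" and V: "csubspace V"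
    and invariant: "\<And>v. v \<in> V \<Longrightarrow> Q v \<in> V"
    and form: "\<And>v. v \<in> V \<Longrightarrow> \<bar>Re (cinner (Q v) v)\<bar> \<le> e * (norm v)\<^sup>2"
    and e: "e \<le> 1" and u: "u \<in> V"
  shows "(norm (Q u))\<^sup>2 \<le> e * (norm u)\<^sup>2"
proof -
  let ?a = u and ?b = "Q u"
  have "u + ?b \<in> V" "u + (- 1) *\<^sub>C ?b \<in> V"
    using V invariant[OF u] u unfolding csubspace_def by blast+
  hence "Re (cinner (Q (u + ?b)) (u + ?b)) \<le> e * (norm (u + ?b))\<^sup>2"
    and "- Re (cinner (Q (u - ?b)) (u - ?b)) \<le> e * (norm (u - ?b))\<^sup>2"
    using form[of "u + ?b"] form[of "u - ?b"] by (auto simp: scaleC_one)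
  moreover have "Re (cinner (Q (u + ?b)) (u + ?b)) - Re (cinner (Q (u - ?b)) (u - ?b)) = 4 * (norm ?b)\<^sup>2"
  proof -
    have "cinner (Q (Q u)) u = cinner (Q u) (Q u)" by (rule is_adjointD[OF Q(2)])
    thus ?thesis by (simp add: bounded_clinear_simps[OF Q(1)] cinner_distribs cinner_self)
  qed
  moreover have "e * (norm (u + ?b))\<^sup>2 + e * (norm (u - ?b))\<^sup>2 = 2 * e * (norm u)\<^sup>2 + 2 * (e * (norm ?b)\<^sup>2)"
    by (simp add: norm_add_square norm_diff_square algebra_simps)
  moreover have "e * (norm ?b)\<^sup>2 \<le> 1 * (norm ?b)\<^sup>2" using e by (intro mult_right_mono) auto
  ultimately show ?thesis by linarith
qed

text \<open>If every pair of concentric cuts is trivial for \<open>Y\<close>, then \<open>Y\<close> lives on a single circle around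
  each centre.\<close>

lemma trivial_cuts_imp_scalar_modulus:
  fixes S :: "'g::chilbert_space \<Rightarrow> 'g" and Y :: "'g \<Rightarrow> 'k::complex_inner"
  assumes nrm: "normal_operator S S'" and Y: "bounded_clinear Y" and nonzero: "Y z \<noteq> 0"
    and trivial: "\<And>t' t P' P. t' < t \<Longrightarrow> disc_cut S S' c t' P' \<Longrightarrow> disc_cut S S' c t P \<Longrightarrow>
      (\<forall>x. Y (P x) = 0) \<or> (\<forall>x. Y (x - P' x) = 0)"
  obtains s :: real where "\<And>x. Y (shift S' (cnj c) (shift S c x)) = s *\<^sub>R Y x"
proof -
  have S: "bounded_clinear S" "is_adjoint S S'" "\<And>x. S (S' x) = S' (S x)"
    using nrm by (auto simp: normal_operator_def)
  have S': "bounded_clinear S'" by (rule bounded_clinear_is_adjoint[OF S(2,1)])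
  note adjs = is_adjoint_shift[OF S(2), of c]
  have "\<forall>t. \<exists>P. disc_cut S S' c t P" using disc_cut_exists[OF nrm] by blast
  then obtain P where cut: "\<And>t. disc_cut S S' c t (P t)" by metis
  have P: "orth_projection (P t)" for t by (rule disc_cut_projection[OF cut])
  have P_lin: "bounded_clinear (P t)" and P_adj: "is_adjoint (P t) (P t)" and PP: "P t (P t x) = P t x" for t x
    using P[of t] by (auto simp: orth_projection_def)
  have P_S: "P t (S x) = S (P t x)" and P_S': "P t (S' x) = S' (P t x)" for t x
    by (rule disc_cut_commute[OF cut S(1,2)], simp_all add: S(3))
      (rule disc_cut_commute[OF cut S' is_adjoint_sym[OF S(2)]], simp_all add: S(3))
  have P_P: "P t (P r x) = P r (P t x)" for t r x
    by (rule disc_cut_commute[OF cut P_lin P_adj]) (simp_all add: P_S P_S')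
  \<comment> \<open>The squared radii of discs on which \<open>Y\<close> vanishes; the supremum will
    be the squared radius of the circle carrying \<open>Y\<close>.\<close>
  define T where "T = {t. \<forall>x. Y (x - P t x) = 0}"
  obtain K where K: "K > 0" "\<And>x. norm (shift S c x) \<le> K * norm x"
    using bounded_clinear_bound[OF bounded_clinear_shift[OF S(1)]] by blast
  have T_le: "t \<le> K\<^sup>2" if "t \<in> T" for t
  proof (rule ccontr)
    assume t: "\<not> t \<le> K\<^sup>2"
    have "P t z = 0"
    proof (rule ccontr)
      assume "P t z \<noteq> 0"
      hence "K\<^sup>2 * (norm (P t z))\<^sup>2 < t * (norm (P t z))\<^sup>2" using t by simp
      also have "\<dots> \<le> (norm (shift S c (P t z)))\<^sup>2" by (rule disc_cut_lower[OF cut])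
      also have "\<dots> \<le> (K * norm (P t z))\<^sup>2" by (intro power_mono K(2)) simp
      finally show False by (simp add: power_mult_distrib)
    qed
    moreover have "Y (z - P t z) = 0" using that unfolding T_def by blast
    ultimately show False using nonzero by simp
  qed
  \<comment> \<open>For negative \<open>t\<close> the upper estimate makes \<open>P t\<close> the
    identity, so \<open>T\<close> is nonempty.\<close>
  have "- 1 \<in> T"
  proof -
    have "x - P (- 1) x = 0" for x
    proof -
      have "0 \<le> (norm (shift S c (x - P (- 1) x)))\<^sup>2" by simp
      also have "\<dots> \<le> - 1 * (norm (x - P (- 1) x))\<^sup>2" by (rule disc_cut_upper[OF cut])
      finally have "(norm (x - P (- 1) x))\<^sup>2 \<le> 0" by simp
      thus ?thesis by simp
    qed
    thus ?thesis by (simp add: T_def bounded_clinear_zero[OF Y])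
  qed
  define s where "s = Sup T"
  have bdd: "bdd_above T" using T_le by (auto simp: bdd_above_def)
  have below: "Y (x - P t x) = 0" if "t < s" for t x
  proof -
    obtain t1 where t1: "t1 \<in> T" "t < t1"
      using less_cSupD[of T t] \<open>- 1 \<in> T\<close> \<open>t < s\<close> unfolding s_def by blast
    have "Y (P t1 z) = Y z"
      using t1(1) bounded_clinear_diff[OF Y, of z "P t1 z"] by (simp add: T_def)
    thus ?thesis using trivial[OF t1(2) cut cut] nonzero by auto
  qed
  have above: "Y (P t x) = 0" if "s < t" for t x
  proof -
    obtain r where r: "s < r" "r < t" using dense[OF \<open>s < t\<close>] by blast
    have "r \<notin> T" using r(1) cSup_upper[OF _ bdd, of r] by (auto simp: s_def)
    thus ?thesis using trivial[OF r(2) cut cut] by (auto simp: T_def)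
  qed
  define Q where "Q x = shift S' (cnj c) (shift S c x) - s *\<^sub>R x" for x
  have Q: "bounded_clinear Q"
    unfolding Q_def by (intro bounded_clinear_minus_fun bounded_clinear_scaleR_fun bounded_clinear_id
        bounded_clinear_compose[OF bounded_clinear_shift[OF S'] bounded_clinear_shift[OF S(1)]])
  have Q_adj: "is_adjoint Q Q"
    by (simp add: is_adjoint_def Q_def cinner_diff_left cinner_diff_right is_adjointD[OF adjs]
        is_adjointD[OF is_adjoint_sym[OF adjs]])
  have Q_form: "Re (cinner (Q x) x) = (norm (shift S c x))\<^sup>2 - s * (norm x)\<^sup>2" for x
    by (simp add: Q_def cinner_diff_left is_adjointD[OF is_adjoint_sym[OF adjs]] cinner_self)
  have P_Q: "P t (Q x) = Q (P t x)" for t x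
    by (simp add: Q_def shift_def bounded_clinear_simps[OF P_lin] P_S P_S')
  obtain L where L: "L > 0" "\<And>x. norm (Y x) \<le> L * norm x"
    using bounded_clinear_bound[OF Y] by blast
  have small: "(norm (Y (Q x)))\<^sup>2 \<le> e * (L * norm x)\<^sup>2" if e: "e > 0" "e \<le> 1" for e x
  proof -
    \<comment> \<open>The spectral annulus around the circle, where the form of \<open>Q\<close> is
      at most \<open>e\<close>. Truncating \<open>x\<close> to it gives \<open>u\<close>, and
      \<open>Y\<close> does not see the parts cut off.\<close>
    define V where "V = {v. P (s - e) v = v \<and> P (s + e) v = 0}"
    have V: "csubspace V"
      by (simp add: csubspace_def V_def bounded_clinear_simps[OF P_lin])
    have invariant: "Q v \<in> V" if "v \<in> V" for v
      using that by (simp add: V_def P_Q bounded_clinear_zero[OF Q])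
    have form: "\<bar>Re (cinner (Q v) v)\<bar> \<le> e * (norm v)\<^sup>2" if "v \<in> V" for v
      using disc_cut_lower[OF cut, of "s - e" v] disc_cut_upper[OF cut, of v "s + e"] that
      by (simp add: V_def Q_form left_diff_distrib distrib_right abs_le_iff)
    define u where "u = P (s - e) (x - P (s + e) x)"
    have "u \<in> V"
      by (simp add: u_def V_def PP P_P[of "s + e"] bounded_clinear_simps[OF P_lin])
    have "norm u \<le> norm (x - P (s + e) x)"
      unfolding u_def by (rule norm_orth_projection_le[OF P])
    also have "\<dots> \<le> norm x" by (rule norm_orth_projection_le[OF orth_projection_complement[OF P]])
    finally have u: "norm u \<le> norm x" .
    have Y_P: "Y (P (s - e) y) = Y y" for y
      using below[of "s - e" y] e(1) by (simp add: bounded_clinear_diff[OF Y])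
    have "Q u = P (s - e) (Q x - P (s + e) (Q x))"
      by (simp add: u_def P_Q[symmetric] bounded_clinear_diff[OF Q])
    hence "Y (Q u) = Y (Q x)"
      using above[of "s + e" "Q x"] e(1) by (simp add: Y_P bounded_clinear_diff[OF Y])
    hence "(norm (Y (Q x)))\<^sup>2 \<le> (L * norm (Q u))\<^sup>2"
      using L(2)[of "Q u"] by (intro power_mono) auto
    also have "\<dots> = L\<^sup>2 * (norm (Q u))\<^sup>2" by (rule power_mult_distrib)
    also have "\<dots> \<le> L\<^sup>2 * (e * (norm x)\<^sup>2)"
    proof (rule mult_left_mono)
      have "(norm (Q u))\<^sup>2 \<le> e * (norm u)\<^sup>2"
        by (rule selfadjoint_norm_le_of_form[OF Q Q_adj V invariant form e(2) \<open>u \<in> V\<close>])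
      also have "\<dots> \<le> e * (norm x)\<^sup>2" using u e(1) by (intro mult_left_mono power_mono) auto
      finally show "(norm (Q u))\<^sup>2 \<le> e * (norm x)\<^sup>2" .
    qed simp
    finally show ?thesis by (simp add: power_mult_distrib mult_ac)
  qed
  have "Y (Q x) = 0" for x
  proof (rule ccontr)
    assume nz: "Y (Q x) \<noteq> 0"
    define q where "q = (norm (Y (Q x)))\<^sup>2"
    define M where "M = (L * norm x)\<^sup>2 + 1"
    have q: "q > 0" using nz by (simp add: q_def)
    have M: "M > 0" by (simp add: M_def add_nonneg_pos)
    \<comment> \<open>Makes \<open>e * M\<close> at most \<open>q / 2\<close>, against
      \<open>q \<le> e * M\<close>.\<close>
    define e where "e = min 1 (q / (2 * M))"
    have e: "e > 0" "e \<le> 1" using q M by (auto simp: e_def)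
    have "q \<le> e * (L * norm x)\<^sup>2" unfolding q_def by (rule small[OF e])
    also have "\<dots> \<le> (q / (2 * M)) * M"
      using q M by (intro mult_mono) (auto simp: e_def M_def)
    also have "\<dots> < q" using q M by simp
    finally show False by simp
  qed
  thus ?thesis
    by (intro that[of s]) (simp add: Q_def bounded_clinear_simps[OF Y])
qed

text \<open>Expanding in \<open>c\<close> and comparing \<open>c = 0\<close> with
  \<open>c = 1\<close> and \<open>c = \<i>\<close> shows that \<open>Y (S + S')\<close> and
  \<open>Y (S - S')\<close> are both scalar multiples of \<open>Y\<close>.\<close>

lemma scalar_moduli_imp_scalar:
  assumes "bounded_clinear S'" "bounded_clinear Y"
    and "\<And>c. \<exists>s::real. \<forall>x. Y (shift S' (cnj c) (shift S c x)) = s *\<^sub>R Y x"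
  obtains l where "\<And>x. Y (S x) = l *\<^sub>C Y x"
proof -
  obtain s where s: "\<And>c x. Y (shift S' (cnj c) (shift S c x)) = s c *\<^sub>R Y x"
    using assms(3) by metis
  have expand: "Y (shift S' (cnj c) (shift S c x)) =
      Y (S' (S x)) - c *\<^sub>C Y (S' x) - cnj c *\<^sub>C Y (S x) + (cnj c * c) *\<^sub>C Y x" for c x
    by (simp add: shift_def bounded_clinear_simps[OF assms(1)] bounded_clinear_simps[OF assms(2)]
        scaleC_distribs scaleC_scaleC)
  have s': "complex_of_real (s c) *\<^sub>C Y x =
      Y (S' (S x)) - c *\<^sub>C Y (S' x) - cnj c *\<^sub>C Y (S x) + (cnj c * c) *\<^sub>C Y x" for c x
    using s[of c x] by (simp only: expand scaleR_scaleC)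
  define \<alpha> where "\<alpha> = complex_of_real (s 0) + 1 - complex_of_real (s 1)"
  define \<beta> where "\<beta> = - \<i> * (complex_of_real (s \<i>) - complex_of_real (s 0) - 1)"
  have sum: "Y (S x) + Y (S' x) = \<alpha> *\<^sub>C Y x" for x
    using s'[of 0 x] s'[of 1 x] by (simp add: \<alpha>_def scaleC_distribs scaleC_one algebra_simps)
  have diff: "Y (S x) - Y (S' x) = \<beta> *\<^sub>C Y x" for x
  proof -
    have "\<beta> *\<^sub>C Y x = (- \<i>) *\<^sub>C (\<i> *\<^sub>C Y (S x) - \<i> *\<^sub>C Y (S' x))"
      using s'[of 0 x] s'[of \<i> x]
      by (simp add: \<beta>_def scaleC_scaleC[symmetric] scaleC_diff_left scaleC_one)
    thus ?thesis by (simp add: scaleC_diff_right scaleC_scaleC scaleC_one)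
  qed
  have "Y (S x) = ((\<alpha> + \<beta>) / 2) *\<^sub>C Y x" for x
  proof -
    have "Y (S x) + Y (S x) = (Y (S x) + Y (S' x)) + (Y (S x) - Y (S' x))" by simp
    also have "\<dots> = (\<alpha> + \<beta>) *\<^sub>C Y x" by (simp only: sum diff scaleC_add_left)
    finally have "(1/2) *\<^sub>C (Y (S x) + Y (S x)) = (1/2) *\<^sub>C ((\<alpha> + \<beta>) *\<^sub>C Y x)" by simp
    moreover have "(1/2) *\<^sub>C (Y (S x) + Y (S x)) = Y (S x)"
      by (simp add: scaleC_add_right scaleC_add_left[symmetric] scaleC_one)
    ultimately show ?thesis by (simp add: scaleC_scaleC)
  qed
  thus ?thesis by (rule that)
qed

section \<open>Hyperinvariant subspaces\<close>

text \<open>The common kernel of all \<open>L X\<close>, with \<open>X\<close> commuting with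
  \<open>T\<close>, is hyperinvariant since these \<open>X\<close> are closed under products;
  \<open>v\<close> makes it nonzero and \<open>u\<close> proper. \<open>L\<close> will be
  \<open>W2\<close> or a functional composed with it.\<close>

lemma nontrivial_hyperinvariant_subspaceI:
  fixes T :: "'h::complex_inner \<Rightarrow> 'h" and L :: "'h \<Rightarrow> 'c::complex_inner"
  assumes L: "bounded_clinear L"
    and X0: "bounded_clinear X0" "X0 \<circ> T = T \<circ> X0" "L (X0 u) \<noteq> 0"
    and v: "v \<noteq> 0" "\<And>X. bounded_clinear X \<Longrightarrow> X \<circ> T = T \<circ> X \<Longrightarrow> L (X v) = 0"
  shows "has_nontrivial_hyperinvariant_subspace T"
proof -
  define C where "C = {X. bounded_clinear X \<and> X \<circ> T = T \<circ> X}"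
  define M where "M = {v. \<forall>X\<in>C. L (X v) = 0}"
  have lin: "bounded_clinear (\<lambda>v. L (X v))" if "X \<in> C" for X
    using that L by (auto simp: C_def intro: bounded_clinear_compose)
  have "csubspace M"
    using L by (auto simp: csubspace_def M_def C_def bounded_clinear_add bounded_clinear_scaleC bounded_clinear_zero)
  moreover have "closed M"
  proof -
    have "M = (\<Inter>X\<in>C. {v. L (X v) = 0})" by (auto simp: M_def)
    moreover have "closed {v. L (X v) = 0}" if "X \<in> C" for X
      by (rule closed_Collect_eq[OF continuous_on_bounded_clinear[OF lin[OF that]] continuous_on_const])
    ultimately show ?thesis by auto
  qed
  moreover have "X v \<in> M" if X: "bounded_clinear X" "X \<circ> T = T \<circ> X" and "v \<in> M" for X v
  proof -
    have "(\<lambda>v. X' (X v)) \<in> C" if "X' \<in> C" for X'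
      using that X bounded_clinear_compose[of X' X] by (auto simp: C_def fun_eq_iff)
    thus ?thesis using \<open>v \<in> M\<close> by (auto simp: M_def)
  qed
  ultimately have "hyperinvariant M T" by (auto simp: hyperinvariant_def)
  moreover have "v \<in> M" using v(2) by (auto simp: M_def C_def)
  moreover have "u \<notin> M" using X0 by (auto simp: M_def C_def)
  ultimately show ?thesis
    using v(1) unfolding has_nontrivial_hyperinvariant_subspace_def by blast
qed

theorem theorem3p1:
  fixes A :: "'g::chilbert_space \<Rightarrow> 'g"
    and B :: "'k::chilbert_space \<Rightarrow> 'k"
    and T :: "'h::chilbert_space \<Rightarrow> 'h"
    and W1 :: "'g \<Rightarrow> 'h" and W2 :: "'h \<Rightarrow> 'k"
    and M :: real
  assumes "separable_space TYPE('g)" "separable_space TYPE('h)" "separable_space TYPE('k)"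
    and "M > 0" and "M_hyponormal M A"
    and "dominant B"
    and "bounded_clinear T"
    and "bounded_clinear W1" and "bounded_clinear W2"
    and "W1 \<noteq> (\<lambda>x. 0)" and "W2 \<noteq> (\<lambda>x. 0)"
    and "W1 \<circ> adjoint A = T \<circ> W1"
    and "W2 \<circ> T = B \<circ> W2"
    and "\<forall>l. T \<noteq> (\<lambda>x. l *\<^sub>C x)"
  shows "has_nontrivial_hyperinvariant_subspace T"
proof -
  note W1 = \<open>bounded_clinear W1\<close> and W2 = \<open>bounded_clinear W2\<close>
  have W1_T: "W1 (adjoint A x) = T (W1 x)" and W2_T: "W2 (T y) = B (W2 y)" for x y
    using assms(12,13) by (auto simp: fun_eq_iff)
  have A: "bounded_clinear A" using assms(5) by (simp add: M_hyponormal_def)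
  note A_adj = is_adjoint_adjoint[OF A]
  have hyp: "norm (shift (adjoint A) (cnj l) x) \<le> sqrt M * norm (shift A l x)" for l x
    using assms(5) by (simp add: M_hyponormal_def adjoint_eqI[OF is_adjoint_shift[OF A_adj]])
  have B: "bounded_clinear B" using assms(6) by (simp add: dominant_def)
  note B_adj = is_adjoint_adjoint[OF B]
  have dom: "\<exists>C. \<forall>x. norm (shift (adjoint B) (cnj l) x) \<le> C * norm (shift B l x)" for l
    using assms(6) by (auto simp: dominant_def adjoint_eqI[OF is_adjoint_shift[OF B_adj]])
  obtain N N' where nrm: "normal_operator N N'"
    and factor: "\<And>Y x. bounded_clinear Y \<Longrightarrow> (\<And>x. Y (adjoint A x) = B (Y x)) \<Longrightarrow> Y (N x) = B (Y x)"
    using intertwiners_factor_through_normal[OF A A_adj hyp _ B B_adj dom] assms(4) by auto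
  define Y where "Y X x = W2 (X (W1 x))" for X x
  have Y_lin: "bounded_clinear (Y X)" if "bounded_clinear X" for X
    unfolding Y_def by (rule bounded_clinear_compose[OF W2 bounded_clinear_compose[OF that W1]])
  have Y_N: "Y X (N x) = B (Y X x)" if "bounded_clinear X" "X \<circ> T = T \<circ> X" for X x
    using that by (intro factor Y_lin) (auto simp: Y_def W1_T W2_T[symmetric] fun_eq_iff)
  show ?thesis
  proof (cases "\<exists>X. bounded_clinear X \<and> X \<circ> T = T \<circ> X \<and> (\<exists>x. Y X x \<noteq> 0)")
    case False
    \<comment> \<open>The range of \<open>W1\<close> lies in the common kernel of all
      \<open>W2 X\<close>, which is proper because \<open>X\<close> may be the identity.\<close>
    obtain g where g: "W1 g \<noteq> 0" using assms(10) by blast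
    obtain u where u: "W2 u \<noteq> 0" using assms(11) by blast
    show ?thesis
      by (rule nontrivial_hyperinvariant_subspaceI[OF W2 bounded_clinear_id _ _ g, of _ u])
        (use False u in \<open>auto simp: Y_def fun_eq_iff\<close>)
  next
    case True
    then obtain X0 z where X0: "bounded_clinear X0" "X0 \<circ> T = T \<circ> X0" and z: "Y X0 z \<noteq> 0" by blast
    note Y0 = Y_lin[OF X0(1)] Y_N[OF X0]
    have L: "bounded_clinear (\<lambda>v. cinner k (W2 v))" for k
    proof -
      have "bounded_clinear (cinner k)"
        by (rule bounded_clinearI[where K = "norm k"])
          (simp_all add: cinner_add_right cinner_scaleC_right scaleC_complex_def cinner_Cauchy_Schwarz)
      thus ?thesis by (rule bounded_clinear_compose[OF _ W2])
    qed
    show ?thesis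
    proof (cases "\<exists>l. \<forall>x. Y X0 (N x) = l *\<^sub>C Y X0 x")
      case True
      then obtain l where l: "\<And>x. Y X0 (N x) = l *\<^sub>C Y X0 x" by blast
      define k where "k = Y X0 z"
      have "shift B l k = 0" using l[of z] Y0(2)[of z] by (simp add: shift_def k_def)
      \<comment> \<open>Dominance turns the eigenvector of \<open>B\<close> into one of its adjoint,
        hence \<open>k\<close> is orthogonal to the range of \<open>B - l\<close>.\<close>
      hence k: "shift (adjoint B) (cnj l) k = 0" using dom[of l] by (metis mult_zero_right norm_le_zero_iff norm_zero)
      \<comment> \<open>Non-scalarity of \<open>T\<close> enters here: it supplies a nonzero vector
        in the range of \<open>T - l\<close>.\<close>
      obtain u where u: "T u \<noteq> l *\<^sub>C u" using assms(14) by (metis ext)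
      show ?thesis
      proof (rule nontrivial_hyperinvariant_subspaceI[OF L X0, of k "W1 z" "T u - l *\<^sub>C u"])
        show "cinner k (W2 (X0 (W1 z))) \<noteq> 0"
          using z by (simp add: k_def Y_def cinner_eq_zero_iff)
        show "T u - l *\<^sub>C u \<noteq> 0" using u by simp
        fix X assume X: "bounded_clinear X" "X \<circ> T = T \<circ> X"
        have "W2 (X (T u - l *\<^sub>C u)) = shift B l (W2 (X u))"
          using X(2) by (simp add: bounded_clinear_simps[OF X(1)] bounded_clinear_simps[OF W2] shift_def
              fun_eq_iff W2_T)
        thus "cinner k (W2 (X (T u - l *\<^sub>C u))) = 0"
          using is_adjointD[OF is_adjoint_sym[OF is_adjoint_shift[OF B_adj]], of l k] k by simp
      qed
    next
      case not_scalar: False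
      \<comment> \<open>If all concentric cuts were trivial, \<open>Y X0\<close> would live on one
        circle around every centre, so \<open>N\<close> would act as a scalar under it.\<close>
      have "\<exists>c t' t P' P. t' < t \<and> disc_cut N N' c t' P' \<and> disc_cut N N' c t P \<and>
        (\<exists>x. Y X0 (P x) \<noteq> 0) \<and> (\<exists>x. Y X0 (x - P' x) \<noteq> 0)"
      proof (rule ccontr)
        assume "\<not> ?thesis"
        hence "\<exists>s::real. \<forall>x. Y X0 (shift N' (cnj c) (shift N c x)) = s *\<^sub>R Y X0 x" for c
          by - (rule trivial_cuts_imp_scalar_modulus[OF nrm Y0(1) z, of c], blast+)
        thus False
          using scalar_moduli_imp_scalar[OF _ Y0(1), of N' N] not_scalar nrm bounded_clinear_is_adjoint
          unfolding normal_operator_def by metis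
      qed
      then obtain c t' t P' P f y where t: "t' < t" and cut': "disc_cut N N' c t' P'"
        and cut: "disc_cut N N' c t P" and f: "Y X0 (P f) \<noteq> 0" and y: "Y X0 (y - P' y) \<noteq> 0" by blast
      \<comment> \<open>A negative \<open>t'\<close> would force \<open>y = P' y\<close>, against
        the choice of \<open>y\<close>.\<close>
      have "t' \<ge> 0"
      proof (rule ccontr)
        assume "\<not> t' \<ge> 0"
        hence "t' * (norm (y - P' y))\<^sup>2 < 0 \<or> y - P' y = 0" by (auto simp: mult_less_0_iff)
        moreover have "0 \<le> t' * (norm (y - P' y))\<^sup>2"
          using disc_cut_upper[OF cut', of y] by (meson order_trans zero_le_power2)
        ultimately show False using y bounded_clinear_zero[OF Y0(1)] by auto
      qed
      show ?thesis
      proof (rule nontrivial_hyperinvariant_subspaceI[OF L X0, of "Y X0 (P f)" "W1 (P f)" "W1 (y - P' y)"])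
        show "cinner (Y X0 (P f)) (W2 (X0 (W1 (P f)))) \<noteq> 0"
          using f by (simp add: Y_def cinner_eq_zero_iff)
        show "W1 (y - P' y) \<noteq> 0"
          using y by (auto simp: Y_def bounded_clinear_zero[OF X0(1)] bounded_clinear_zero[OF W2])
        fix X assume X: "bounded_clinear X" "X \<circ> T = T \<circ> X"
        show "cinner (Y X0 (P f)) (W2 (X (W1 (y - P' y)))) = 0"
          using intertwiners_disc_cut_orthogonal[OF nrm B B_adj dom Y0 Y_lin[OF X(1)] Y_N[OF X] cut cut' \<open>t' \<ge> 0\<close> t]
          by (simp add: Y_def)
      qed
    qed
  qed
qed

end
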